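(* Let $n,m,p,q\ge 1$ and $r\ge 0$ be integers, $l=n+(r+1)q$, $h\ge0$, $T\ge 0$, $\epsilon_r\ge 0$, $t_0\in\mathbb{R}$, and consider the system $$\dot x(t)=Ax(t)+B_uu(t-h)+B_\omega\omega(t),\qquad y(t)=C_xx(t)+D_\omega\omega(t),\qquad t\ge t_0,$$ with $x(t)\in\mathbb{R}^n$, $u(t)\in\mathbb{R}^m$, $\omega(t)\in\mathbb{R}^q$, $y(t)\in\mathbb{R}^p$ and real matrices of appropriate dimensions. Assume: (1) $\omega:\mathbb{R}\to\mathbb{R}^q$ is $(r+1)$-times continuously differentiable with $\|\omega^{(r+1)}(s)\|\le\epsilon_r$ for all $s\in\mathbb{R}$; (2) $u:[t_0-h,\infty)\to\mathbb{R}^m$ is piecewise constant (finitely many jumps in each bounded interval); (3) the pair $(\bar A,\bar C)$ is observable. Let $\mathcal{D}=\{z\in\mathbb{C}: N_{\mathcal D}+zM_{\mathcal D}+z^*M_{\mathcal D}^T\prec0\}$ be a bounded set, where $N_{\mathcal D}=N_{\mathcal D}^T$ and $M_{\mathcal D}$ are real square matrices of the same size. Suppose that $\alpha>0$, $\delta>0$, a symmetric positive definite $P\in\mathbb{R}^{l\times l}$ and $Y\in\mathbb{R}^{l\times p}$ satisfy $$\begin{bmatrix}P\bar A+\bar A^TP-Y\bar C-\bar C^TY^T+2\delta P & P\bar B_\omega\\ \bar B_\omega^TP & -I_q\end{bmatrix}\preceq0,$$ $$P-\alpha K(T)^TK(T)\succeq0,$$ $$N_{\mathcal D}\otimes P+M_{\mathcal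 D}\otimes(P\bar A-Y\bar C)+M_{\mathcal D}^T\otimes(P\bar A-Y\bar C)^T\prec0,$$ and let $L=P^{-1}Y$. Let $\hat\eta$ be any solution on $[t_0,\infty)$ (with arbitrary initial value $\hat\eta(t_0)\in\mathbb{R}^l$) of the observer $$\dot{\hat\eta}(t)=(\bar A-L\bar C)\hat\eta(t)+\bar B_uu(t-h)+Ly(t),\qquad \xi(t)=K(T)\hat\eta(t).$$ For $t\ge t_0$, let $t-h<t_1<\dots<t_N<t+T-h$ ($N\ge1$) and $u_0,\dots,u_N\in\mathbb{R}^m$ be such that $u=u_0$ on $[t-h,t_1)$, $u=u_k$ on $[t_k,t_{k+1})$ for $1\le k\le N-1$, and $u=u_N$ on $[t_N,t+T-h]$, and define the prediction $$\hat x(t+T)=\xi(t)+\boldsymbol{\Gamma}_u\,\boldsymbol{u}_{0-N}.$$ Then $$x(t+T)-\hat x(t+T)=\mathcal{O}_r(t)+\mathcal{O}_e(t),$$ where $\mathcal{O}_e(t)=K(T)(\eta(t)-\hat\eta(t))$ and $\mathcal{O}_r(t)=\int_t^{t+T}\frac{(t+T-s)^{r+1}}{(r+1)!}\Gamma_{\omega,r}(t+T-s)B_\omega\,\omega^{(r+1)}(s)\,ds$. Moreover, for all $t\ge t_0$, $$\|\mathcal{O}_r(t)\|\le\frac{T^{r+2}}{(r+2)!}\,\mu\,\epsilon_r,\qquad \mu=\max_{s\in[t,t+T]}\|\Gamma_{\omega,r}(t+T-s)B_\omega\|,$$ while $\mathcal{O}_e$ is ultimately bounded by $\epsilon_r\sqrt{\frac{1}{2\alpha\delta}}$,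 i.e. $\limsup_{t\to\infty}\|\mathcal{O}_e(t)\|\le\epsilon_r\sqrt{\frac{1}{2\alpha\delta}}$; both of these bounds are zero when $\epsilon_r=0$.
   Context: Norms are Euclidean (and the induced norm for matrices); $\prec,\preceq,\succeq$ denote the (semi)definite order on symmetric/Hermitian matrices; $z^*$ is the complex conjugate; $\otimes$ is the Kronecker product. Solutions of the differential equations are continuous and satisfy the equation except possibly at the jump instants of $u(\cdot-h)$. $\Phi(T)=e^{AT}$. $\boldsymbol{\omega}_r(t)=[\omega(t)^T,\dot\omega(t)^T,\dots,\omega^{(r)}(t)^T]^T\in\mathbb{R}^{(r+1)q}$, $\eta(t)=[x(t)^T,\boldsymbol{\omega}_r(t)^T]^T\in\mathbb{R}^l$, $\boldsymbol{u}_{0-N}=[u_0^T,\dots,u_N^T]^T$. For $i=0,\dots,r$: $\Gamma_{\omega,i}(\tau)=\sum_{j=0}^\infty\frac{(i+1)!}{(i+1+j)!}A^j\tau^j$, and $\boldsymbol{\Gamma}_\omega(T)=\big[T\Gamma_{\omega,0}(T)B_\omega,\dots,\frac{T^{r+1}}{(r+1)!}\Gamma_{\omega,r}(T)B_\omega\big]$, with $i$-th block $\frac{T^{i+1}}{(i+1)!}\Gamma_{\omega,i}(T)B_\omega$. For $a\le b\le t+T$: $\Gamma_u(a,b)=\int_a^be^{A(t+T-s)}B_u\,ds$, and $\boldsymbol{\Gamma}_u=[\Gamma_u(t,t_1+h),\Gamma_u(t_1+h,t_2+h),\dots,\Gamma_u(t_{N-1}+h,t_N+h),\Gamma_u(t_N+h,t+T)]$.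 Augmented matrices: $$\bar A=\begin{bmatrix}A&B_\omega\Pi\\0&\Psi\end{bmatrix},\quad \Psi=\begin{bmatrix}0_{rq\times q}&I_{rq}\\0_{q\times q}&0_{q\times rq}\end{bmatrix},\quad \Pi=\begin{bmatrix}I_q&0_{q\times rq}\end{bmatrix},\quad \bar B_u=\begin{bmatrix}B_u\\0_{(r+1)q\times m}\end{bmatrix},$$ $$\bar C=\begin{bmatrix}C_x&D_\omega&0_{p\times rq}\end{bmatrix},\quad \bar B_\omega=\begin{bmatrix}0_{q\times(n+rq)}&I_q\end{bmatrix}^T,\quad K(T)=\begin{bmatrix}\Phi(T)&\boldsymbol{\Gamma}_\omega(T)\end{bmatrix}.$$ (For $r=0$, $\Psi=0_{q\times q}$ and $\Pi=I_q$.) *)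

theory Defs
  imports "HOL-Analysis.Analysis"
begin

text \<open>Block matrices are indexed by sum types (\<open>Inl\<close>: first block, \<open>Inr\<close>: second block).\<close>

definition hblock :: "real^'c^'a \<Rightarrow> real^'d^'a \<Rightarrow> real^('c + 'd)^'a" where
  "hblock M N = (\<chi> i j. case j of Inl c \<Rightarrow> M $ i $ c | Inr d \<Rightarrow> N $ i $ d)"

definition vblock :: "real^'c^'a \<Rightarrow> real^'c^'b \<Rightarrow> real^'c^('a + 'b)" where
  "vblock M N = (\<chi> i. case i of Inl a \<Rightarrow> M $ a | Inr b \<Rightarrow> N $ b)"

definition block :: "real^'c^'a \<Rightarrow> real^'d^'a \<Rightarrow> real^'c^'b \<Rightarrow> real^'d^'b \<Rightarrow> real^('c + 'd)^('a + 'b)" where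
  "block M11 M12 M21 M22 = vblock (hblock M11 M12) (hblock M21 M22)"

definition kron :: "real^'b^'a \<Rightarrow> real^'d^'c \<Rightarrow> real^('b \<times> 'd)^('a \<times> 'c)" where
  "kron M N = (\<chi> i j. M $ fst i $ fst j * N $ snd i $ snd j)"

definition psd :: "real^'a^'a \<Rightarrow> bool" where
  "psd M \<longleftrightarrow> transpose M = M \<and> (\<forall>v. 0 \<le> v \<bullet> (M *v v))"

definition pd :: "real^'a^'a \<Rightarrow> bool" where
  "pd M \<longleftrightarrow> transpose M = M \<and> (\<forall>v. v \<noteq> 0 \<longrightarrow> 0 < v \<bullet> (M *v v))"

definition loewner_le :: "real^'a^'a \<Rightarrow> real^'a^'a \<Rightarrow> bool" (infix "\<preceq>" 50) where
  "M \<preceq> N \<longleftrightarrow> psd (N - M)"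

definition loewner_less :: "real^'a^'a \<Rightarrow> real^'a^'a \<Rightarrow> bool" (infix "\<prec>" 50) where
  "M \<prec> N \<longleftrightarrow> pd (N - M)"

definition hermitian_neg_def :: "complex^'a^'a \<Rightarrow> bool" where
  "hermitian_neg_def H \<longleftrightarrow> (\<forall>i j. H $ j $ i = cnj (H $ i $ j)) \<and>
     (\<forall>v :: complex^'a. v \<noteq> 0 \<longrightarrow> Re (\<Sum>i\<in>UNIV. \<Sum>j\<in>UNIV. cnj (v $ i) * H $ i $ j * v $ j) < 0)"

definition lmi_region :: "real^'d^'d \<Rightarrow> real^'d^'d \<Rightarrow> complex set" where
  "lmi_region N M = {z. hermitian_neg_def
     (\<chi> i j. of_real (N $ i $ j) + z * of_real (M $ i $ j) + cnj z * of_real (transpose M $ i $ j))}"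

text \<open>Neither \<open>^\<close> nor \<open>exp\<close> refers to the matrix product: multiplication on the
  type of vectors is componentwise.\<close>

definition matpow :: "real^'n^'n \<Rightarrow> nat \<Rightarrow> real^'n^'n" where
  "matpow A k = (((**) A) ^^ k) (mat 1)"

definition matexp :: "real^'n^'n \<Rightarrow> real^'n^'n" where
  "matexp A = (\<Sum>k. (1 / fact k) *\<^sub>R matpow A k)"

text \<open>Full rank of the observability matrix with block rows \<open>C A\<^sup>k\<close>, \<open>k < l\<close>; its rank is
  taken as the dimension of the span of its rows.\<close>

definition observable :: "real^'l^'l \<Rightarrow> real^'l^'p \<Rightarrow> bool" where
  "observable A C \<longleftrightarrow> dim (\<Union>k<CARD('l). rows (C ** matpow A k)) = CARD('l)"

definition nderiv :: "nat \<Rightarrow> (real \<Rightarrow> 'a::real_normed_vector) \<Rightarrow> real \<Rightarrow> 'a" where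
  "nderiv k f = ((\<lambda>g t. vector_derivative g (at t)) ^^ k) f"

definition times_cont_diff :: "nat \<Rightarrow> (real \<Rightarrow> 'a::real_normed_vector) \<Rightarrow> bool" where
  "times_cont_diff k f \<longleftrightarrow>
     (\<forall>j<k. \<forall>t. nderiv j f differentiable (at t)) \<and> continuous_on UNIV (nderiv k f)"

text \<open>Functions on a half-line \<open>{a..}\<close> are total functions whose values below \<open>a\<close> are ignored.\<close>

definition jumps :: "(real \<Rightarrow> 'a::topological_space) \<Rightarrow> real \<Rightarrow> real set" where
  "jumps u a = {s \<in> {a..}. \<not> continuous (at s within {a..}) u}"

definition piecewise_constant :: "(real \<Rightarrow> 'a::topological_space) \<Rightarrow> real \<Rightarrow> bool" where
  "piecewise_constant u a \<longleftrightarrow>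
     (\<forall>b. finite (jumps u a \<inter> {a..b})) \<and>
     (\<forall>s s'. a \<le> s \<and> s \<le> s' \<and> {s..s'} \<inter> jumps u a = {} \<longrightarrow> u s = u s')"

text \<open>\<open>z\<close> solves \<open>z' = f(t, z)\<close> on \<open>{t0..}\<close> off the exceptional set \<open>J\<close> (one-sided derivative at \<open>t0\<close>).\<close>

definition solves_off ::
  "(real \<Rightarrow> 'a) \<Rightarrow> (real \<Rightarrow> 'a \<Rightarrow> 'a::real_normed_vector) \<Rightarrow> real \<Rightarrow> real set \<Rightarrow> bool" where
  "solves_off z f t0 J \<longleftrightarrow> continuous_on {t0..} z \<and>
     (\<forall>t\<ge>t0. t \<notin> J \<longrightarrow> (z has_vector_derivative f t (z t)) (at t within {t0..}))"

text \<open>The stacked vector of \<open>\<omega>\<close> and its derivatives has index type \<open>'k \<times> 'q\<close>, where the finite linearly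
  ordered type \<open>'k\<close> has \<open>r + 1\<close> elements; \<open>pos i\<close> is the number in \<open>{0..r}\<close> of block \<open>i\<close>.\<close>

definition pos :: "'k::{finite,linorder} \<Rightarrow> nat" where
  "pos i = card {j. j < i}"

definition eta :: "(real \<Rightarrow> real^'n) \<Rightarrow> (real \<Rightarrow> real^'q) \<Rightarrow> real \<Rightarrow> real^('n + 'k::{finite,linorder} \<times> 'q)" where
  "eta x w t = (\<chi> i. case i of Inl a \<Rightarrow> x t $ a | Inr (k, b) \<Rightarrow> nderiv (pos k) w t $ b)"

text \<open>In terms of \<open>q \<times> q\<close> blocks, \<open>Psi\<close> has identities on the first superdiagonal and zeros elsewhere
  (\<open>[0, I; 0, 0]\<close>, and \<open>0\<close> if \<open>r = 0\<close>), and \<open>Pi_first\<close> is \<open>[I, 0]\<close>.\<close>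

definition Psi :: "real^('k::{finite,linorder} \<times> 'q::finite)^('k \<times> 'q)" where
  "Psi = (\<chi> i j. if pos (fst j) = Suc (pos (fst i)) \<and> snd j = snd i then 1 else 0)"

definition Pi_first :: "real^('k::{finite,linorder} \<times> 'q)^'q" where
  "Pi_first = (\<chi> a j. if pos (fst j) = 0 \<and> snd j = a then 1 else 0)"

definition A_bar :: "real^'n^'n \<Rightarrow> real^'q^'n \<Rightarrow> real^('n + 'k::{finite,linorder} \<times> 'q)^('n + 'k \<times> 'q)" where
  "A_bar A Bw = block A (Bw ** Pi_first) 0 Psi"

definition Bu_bar :: "real^'m^'n \<Rightarrow> real^'m^('n + 'k::{finite,linorder} \<times> 'q::finite)" where
  "Bu_bar Bu = vblock Bu 0"

text \<open>\<open>D\<^sub>\<omega> \<Pi>\<close> is the block row \<open>[D\<^sub>\<omega>, 0]\<close>.\<close>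

definition C_bar :: "real^'n^'p \<Rightarrow> real^'q^'p \<Rightarrow> real^('n + 'k::{finite,linorder} \<times> 'q)^'p" where
  "C_bar Cx Dw = hblock Cx (Dw ** Pi_first)"

definition Bw_bar :: "real^'q^('n::finite + 'k::{finite,linorder} \<times> 'q)" where
  "Bw_bar = vblock 0 (\<chi> i a. if Suc (pos (fst i)) = CARD('k) \<and> snd i = a then 1 else 0)"

definition Gamma_w :: "real^'n^'n \<Rightarrow> nat \<Rightarrow> real \<Rightarrow> real^'n^'n" where
  "Gamma_w A i \<tau> = (\<Sum>j. (fact (i + 1) / fact (i + 1 + j) * \<tau> ^ j) *\<^sub>R matpow A j)"

definition Gamma_w_row :: "real^'n^'n \<Rightarrow> real^'q^'n \<Rightarrow> real \<Rightarrow> real^('k::{finite,linorder} \<times> 'q)^'n" where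
  "Gamma_w_row A Bw T = (\<chi> a j.
     ((T ^ (pos (fst j) + 1) / fact (pos (fst j) + 1)) *\<^sub>R (Gamma_w A (pos (fst j)) T ** Bw)) $ a $ snd j)"

definition K_mat :: "real^'n^'n \<Rightarrow> real^'q^'n \<Rightarrow> real \<Rightarrow> real^('n + 'k::{finite,linorder} \<times> 'q)^'n" where
  "K_mat A Bw T = hblock (matexp (T *\<^sub>R A)) (Gamma_w_row A Bw T)"

text \<open>In \<open>Gamma_u\<close> the argument \<open>c\<close> is the horizon \<open>t + T\<close>.\<close>

definition Gamma_u :: "real^'n^'n \<Rightarrow> real^'m^'n \<Rightarrow> real \<Rightarrow> real \<Rightarrow> real \<Rightarrow> real^'m^'n" where
  "Gamma_u A Bu c a b = integral {a..b} (\<lambda>s. matexp ((c - s) *\<^sub>R A) ** Bu)"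

text \<open>The block row \<open>[\<Gamma>\<^sub>u(t, t\<^sub>1 + h), \<Gamma>\<^sub>u(t\<^sub>1 + h, t\<^sub>2 + h), \<dots>, \<Gamma>\<^sub>u(t\<^sub>N + h, t + T)]\<close> times the stacked
  vector \<open>[u\<^sub>0; \<dots>; u\<^sub>N]\<close>, written out blockwise; \<open>tk\<close> is used at \<open>1..N\<close> and \<open>uk\<close> at \<open>0..N\<close>.\<close>

definition Gamma_u_times ::
  "real^'n^'n \<Rightarrow> real^'m^'n \<Rightarrow> real \<Rightarrow> real \<Rightarrow> real \<Rightarrow> nat \<Rightarrow> (nat \<Rightarrow> real) \<Rightarrow> (nat \<Rightarrow> real^'m) \<Rightarrow> real^'n" where
  "Gamma_u_times A Bu h T t N tk uk =
     (\<Sum>k\<le>N. Gamma_u A Bu (t + T) (if k = 0 then t else tk k + h)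
                                 (if k = N then t + T else tk (Suc k) + h) *v uk k)"

definition input_partition ::
  "(real \<Rightarrow> 'b) \<Rightarrow> real \<Rightarrow> real \<Rightarrow> real \<Rightarrow> nat \<Rightarrow> (nat \<Rightarrow> real) \<Rightarrow> (nat \<Rightarrow> 'b) \<Rightarrow> bool" where
  "input_partition u h T t N tk uk \<longleftrightarrow>
     1 \<le> N \<and> t - h < tk 1 \<and> (\<forall>k\<in>{1..<N}. tk k < tk (Suc k)) \<and> tk N < t + T - h \<and>
     (\<forall>s\<in>{t - h..<tk 1}. u s = uk 0) \<and>
     (\<forall>k\<in>{1..<N}. \<forall>s\<in>{tk k..<tk (Suc k)}. u s = uk k) \<and>
     (\<forall>s\<in>{tk N..t + T - h}. u s = uk N)"

definition O_r :: "real^'n^'n \<Rightarrow> real^'q^'n \<Rightarrow> nat \<Rightarrow> (real \<Rightarrow> real^'q) \<Rightarrow> real \<Rightarrow> real \<Rightarrow> real^'n" where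
  "O_r A Bw r w T t = integral {t..t + T} (\<lambda>s.
     ((t + T - s) ^ (r + 1) / fact (r + 1)) *\<^sub>R ((Gamma_w A r (t + T - s) ** Bw) *v nderiv (r + 1) w s))"

definition O_e :: "real^'n^'n \<Rightarrow> real^'q^'n \<Rightarrow> real \<Rightarrow> (real \<Rightarrow> real^'n) \<Rightarrow> (real \<Rightarrow> real^'q) \<Rightarrow>
    (real \<Rightarrow> real^('n + 'k::{finite,linorder} \<times> 'q)) \<Rightarrow> real \<Rightarrow> real^'n" where
  "O_e A Bw T x w eta_hat t = K_mat A Bw T *v (eta x w t - eta_hat t)"

end

theory Submission
  imports Defs
begin

text \<open>Along \<open>s \<in> [t, t + T]\<close>, differentiate \<open>\<Phi>(t + T - s) x(s) + \<Sum>\<^sub>i M\<^sub>i\<^sub>+\<^sub>1(t + T - s) B\<^sub>\<omega> \<omega>\<^sup>(\<^sup>i\<^sup>)(s)\<close>, where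
  \<open>M\<^sub>i(\<tau>) = \<tau>\<^sup>i/i! \<Gamma>\<^sub>\<omega>\<^sub>,\<^sub>i\<^sub>-\<^sub>1(\<tau>)\<close> (and \<open>M\<^sub>0 = \<Phi>\<close>) satisfies \<open>M\<^sub>i\<^sub>+\<^sub>1' = M\<^sub>i\<close>: the derivative telescopes to the input term and the
  integrand of the remainder, and the value at \<open>s = t\<close> is \<open>K(T) \<eta>(t)\<close>. The observer error \<open>e\<close> satisfies
  \<open>e' = (A - LC) e + B\<^sub>\<omega> \<omega>\<^sup>(\<^sup>r\<^sup>+\<^sup>1\<^sup>)\<close> for the augmented matrices, so the first matrix inequality gives
  \<open>V' \<le> - 2\<delta>V + \<epsilon>\<^sub>r\<^sup>2\<close> for \<open>V = e\<^sup>T P e\<close>, and the second one bounds \<open>\<alpha> \<parallel>K(T) e\<parallel>\<^sup>2\<close> by \<open>V\<close>.\<close>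

section \<open>Matrix power series\<close>

lemma bounded_bilinear_matrix_vector_mult:
  "bounded_bilinear ((*v) :: real^'n^'m \<Rightarrow> real^'n \<Rightarrow> real^'m)"
  unfolding bilinear_conv_bounded_bilinear[symmetric] bilinear_def
  by (auto intro!: linearI
      simp: matrix_vector_right_distrib matrix_vector_mult_add_rdistrib matrix_vector_mult_scaleR
        simp flip: scaleR_matrix_vector_assoc)

lemma has_vector_derivative_vec:
  fixes f :: "real \<Rightarrow> 'a::real_normed_vector^'n"
  assumes "\<And>i. ((\<lambda>t. f t $ i) has_vector_derivative f' $ i) (at t within S)"
  shows "(f has_vector_derivative f') (at t within S)"
  unfolding has_vector_derivative_def has_derivative_within
proof
  show "bounded_linear (\<lambda>h. h *\<^sub>R f')"
    by (rule bounded_linear_scaleR_left)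
  show "((\<lambda>y. (1 / norm (y - t)) *\<^sub>R (f y - (f t + (y - t) *\<^sub>R f'))) \<longlongrightarrow> 0) (at t within S)"
    using assms unfolding has_vector_derivative_def has_derivative_within
    by (intro vec_tendstoI) simp
qed

text \<open>Each further factor \<open>A\<close> costs at most the largest absolute row sum, and the
  sum over all entries dominates every row sum. The summand 1 makes the base at least 1, so that the
  exponent may later be increased.\<close>

lemma abs_matpow_le:
  fixes A :: "real^'n^'n"
  shows "\<bar>matpow A j $ a $ b\<bar> \<le> (1 + (\<Sum>a\<in>UNIV. \<Sum>b\<in>UNIV. \<bar>A $ a $ b\<bar>)) ^ j" (is "_ \<le> ?R ^ j")
proof (induction j arbitrary: a b)
  case 0
  then show ?case by (simp add: matpow_def mat_def)
next
  case (Suc j)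
  have row: "(\<Sum>k\<in>UNIV. \<bar>A $ a $ k\<bar>) \<le> ?R"
  proof -
    have "(\<Sum>k\<in>UNIV. \<bar>A $ a $ k\<bar>) \<le> (\<Sum>a\<in>UNIV. \<Sum>k\<in>UNIV. \<bar>A $ a $ k\<bar>)"
      by (rule member_le_sum) (auto intro: sum_nonneg)
    then show ?thesis by simp
  qed
  have R: "0 \<le> ?R" by (auto intro!: add_nonneg_nonneg sum_nonneg)
  have "\<bar>matpow A (Suc j) $ a $ b\<bar> = \<bar>\<Sum>k\<in>UNIV. A $ a $ k * matpow A j $ k $ b\<bar>"
    by (simp add: matpow_def matrix_matrix_mult_def)
  also have "\<dots> \<le> (\<Sum>k\<in>UNIV. \<bar>A $ a $ k\<bar> * ?R ^ j)"
    by (rule order_trans[OF sum_abs]) (auto intro!: sum_mono mult_left_mono Suc simp: abs_mult)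
  also have "\<dots> \<le> ?R * ?R ^ j"
    unfolding sum_distrib_right[symmetric] by (intro mult_right_mono row zero_le_power R)
  finally show ?case by simp
qed

text \<open>Comparison with the exponential series at \<open>R * \<bar>z\<bar>\<close>. Both
  \<open>iter_matexp\<close> and \<open>Gamma_w\<close> are handled by this one majorant.\<close>

lemma summable_exp_majorant:
  fixes c :: "nat \<Rightarrow> real"
  assumes "\<And>n. \<bar>c n\<bar> \<le> R ^ n / fact n" and "0 \<le> R"
  shows "summable (\<lambda>n. c n * z ^ n)"
proof (rule summable_comparison_test)
  have "norm (c n * z ^ n) \<le> inverse (fact n) * (R * \<bar>z\<bar>) ^ n" for n
    using mult_right_mono[OF assms(1)[of n], of "\<bar>z\<bar> ^ n"]
    by (simp add: abs_mult power_abs power_mult_distrib divide_inverse mult_ac)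
  then show "\<exists>N. \<forall>n\<ge>N. norm (c n * z ^ n) \<le> inverse (fact n) * (R * \<bar>z\<bar>) ^ n"
    by blast
  show "summable (\<lambda>n. inverse (fact n) * (R * \<bar>z\<bar>) ^ n)"
    by (rule summable_exp)
qed

lemma sums_vec:
  fixes f :: "nat \<Rightarrow> 'a::real_normed_vector^'n"
  assumes "\<And>i. (\<lambda>n. f n $ i) sums (s $ i)"
  shows "f sums s"
  using assms unfolding sums_def by (auto intro!: vec_tendstoI)

text \<open>The index is the exponent of \<tau>, not the power of \<open>A\<close>, with zeros below
  \<open>i\<close>. In this form termwise differentiation is the operator
  \<open>diffs\<close>.\<close>

definition iter_matexp_coeff :: "nat \<Rightarrow> real^'n^'n \<Rightarrow> 'n \<Rightarrow> 'n \<Rightarrow> nat \<Rightarrow> real" where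
  "iter_matexp_coeff i A a b n = (if n < i then 0 else matpow A (n - i) $ a $ b / fact n)"

text \<open>The \<open>i\<close>-fold antiderivative \<open>\<Sum>\<^sub>j \<tau>\<^sup>i\<^sup>+\<^sup>j A\<^sup>j / (i + j)!\<close> of \<open>\<Phi>\<close>, defined entrywise so that the theory of
  real power series applies.\<close>

definition iter_matexp :: "nat \<Rightarrow> real^'n^'n \<Rightarrow> real \<Rightarrow> real^'n^'n" where
  "iter_matexp i A \<tau> = (\<chi> a b. \<Sum>n. iter_matexp_coeff i A a b n * \<tau> ^ n)"

lemma summable_iter_matexp: "summable (\<lambda>n. iter_matexp_coeff i A a b n * \<tau> ^ n)"
proof (rule summable_exp_majorant)
  let ?R = "1 + (\<Sum>a\<in>UNIV. \<Sum>b\<in>UNIV. \<bar>A $ a $ b\<bar>)"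
  have R: "1 \<le> ?R" by (auto intro!: sum_nonneg)
  then show "0 \<le> ?R" by linarith
  fix n
  have "\<bar>matpow A (n - i) $ a $ b\<bar> \<le> ?R ^ n"
    by (rule order_trans[OF abs_matpow_le power_increasing[OF _ R]]) simp
  then show "\<bar>iter_matexp_coeff i A a b n\<bar> \<le> ?R ^ n / fact n"
    using R by (auto simp: iter_matexp_coeff_def divide_right_mono)
qed

text \<open>\<open>diffs\<close> shifts the index by one and cancels one factor of the factorial.
  The difference \<open>n - i\<close> stays the same when \<open>i\<close> drops by one as well, so
  the power of \<open>A\<close> is unchanged.\<close>

lemma iter_matexp_Suc_has_vector_derivative:
  "(iter_matexp (Suc i) A has_vector_derivative iter_matexp i A \<tau>) (at \<tau>)"
proof (intro has_vector_derivative_vec)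
  fix a b
  have "diffs (iter_matexp_coeff (Suc i) A a b) = iter_matexp_coeff i A a b"
    by (auto simp: fun_eq_iff diffs_def iter_matexp_coeff_def simp del: of_nat_Suc)
  then show "((\<lambda>t. iter_matexp (Suc i) A t $ a $ b) has_vector_derivative iter_matexp i A \<tau> $ a $ b) (at \<tau>)"
    using termdiffs_strong_converges_everywhere[OF summable_iter_matexp[of "Suc i" A a b], of \<tau>]
    by (simp add: iter_matexp_def has_real_derivative_iff_has_vector_derivative)
qed

text \<open>At level 0 the shift of the index raises the power of \<open>A\<close> instead, which
  produces the extra factor.\<close>

lemma iter_matexp_0_has_vector_derivative:
  "(iter_matexp 0 A has_vector_derivative iter_matexp 0 A \<tau> ** A) (at \<tau>)"
proof (intro has_vector_derivative_vec)
  \<comment> \<open>\<open>matpow\<close> multiplies from the left, but the factor is wanted on the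
    right, where it meets the term \<open>A *v x s\<close> of the plant.\<close>
  have comm: "A ** matpow A n = matpow A n ** A" for n
    by (induction n) (auto simp: matpow_def matrix_mul_assoc)
  fix a b
  have coeff: "diffs (iter_matexp_coeff 0 A a b) n = (\<Sum>k\<in>UNIV. iter_matexp_coeff 0 A a k n * A $ k $ b)" for n
  proof -
    have "matpow A (Suc n) = matpow A n ** A"
      using comm[of n] by (simp add: matpow_def)
    then have "matpow A (Suc n) $ a $ b = (\<Sum>k\<in>UNIV. matpow A n $ a $ k * A $ k $ b)"
      by (simp add: matrix_matrix_mult_def)
    then show ?thesis
      by (auto simp: diffs_def iter_matexp_coeff_def sum_divide_distrib simp del: of_nat_Suc)
  qed
  have "(\<lambda>n. \<Sum>k\<in>UNIV. iter_matexp_coeff 0 A a k n * \<tau> ^ n * A $ k $ b) sums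
      (\<Sum>k\<in>UNIV. iter_matexp 0 A \<tau> $ a $ k * A $ k $ b)"
    by (intro sums_sum sums_mult2) (simp add: iter_matexp_def summable_sums summable_iter_matexp)
  then have "(\<Sum>n. diffs (iter_matexp_coeff 0 A a b) n * \<tau> ^ n) = (iter_matexp 0 A \<tau> ** A) $ a $ b"
    by (simp add: sums_iff coeff matrix_matrix_mult_def sum_distrib_left sum_distrib_right mult_ac)
  then show "((\<lambda>t. iter_matexp 0 A t $ a $ b) has_vector_derivative (iter_matexp 0 A \<tau> ** A) $ a $ b) (at \<tau>)"
    using termdiffs_strong_converges_everywhere[OF summable_iter_matexp[of 0 A a b], of \<tau>]
    by (simp add: iter_matexp_def has_real_derivative_iff_has_vector_derivative)
qed

lemma continuous_on_iter_matexp: "continuous_on S (iter_matexp i A)"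
proof -
  have "isCont (iter_matexp i A) \<tau>" for \<tau>
    by (cases i) (auto intro: has_vector_derivative_continuous
        iter_matexp_0_has_vector_derivative iter_matexp_Suc_has_vector_derivative)
  then show ?thesis by (simp add: continuous_at_imp_continuous_on)
qed

text \<open>Only the constant coefficient survives. At the end of the horizon every disturbance term
  of the predictor therefore vanishes and the state itself remains.\<close>

lemma iter_matexp_at_0:
  "iter_matexp 0 A 0 = mat 1" "iter_matexp (Suc i) A 0 = 0"
  by (simp_all only: iter_matexp_def powser_zero) (auto simp: vec_eq_iff iter_matexp_coeff_def matpow_def mat_def)

section \<open>Series of matrices: \<Phi> and \<open>Gamma_w\<close>\<close>

lemma iter_matexp_sums:
  "(\<lambda>j. (\<tau> ^ (i + j) / fact (i + j)) *\<^sub>R matpow A j) sums iter_matexp i A \<tau>"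
proof (intro sums_vec)
  fix a b
  \<comment> \<open>The first \<open>i\<close> coefficients are zero, so dropping them does not
    change the sum.\<close>
  have "(\<lambda>n. iter_matexp_coeff i A a b (n + i) * \<tau> ^ (n + i)) sums iter_matexp i A \<tau> $ a $ b"
    using summable_sums[OF summable_iter_matexp[of i A a b \<tau>]]
    by (subst sums_iff_shift) (auto simp: iter_matexp_coeff_def iter_matexp_def)
  then show "(\<lambda>j. ((\<tau> ^ (i + j) / fact (i + j)) *\<^sub>R matpow A j) $ a $ b) sums iter_matexp i A \<tau> $ a $ b"
    by (simp add: iter_matexp_coeff_def add.commute mult.commute)
qed

lemma matpow_scaleR: "matpow (c *\<^sub>R A) j = c ^ j *\<^sub>R matpow A j"
  by (induction j) (auto simp: matpow_def scalar_matrix_assoc matrix_scalar_ac mult.commute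
      simp flip: scalar_mult_eq_scaleR)

lemma matexp_scaleR: "matexp (\<tau> *\<^sub>R A) = iter_matexp 0 A \<tau>"
  using iter_matexp_sums[of \<tau> 0 A]
  by (simp add: matexp_def matpow_scaleR sums_iff)

lemma Gamma_w_summable:
  "summable (\<lambda>j. fact (i + 1) / fact (i + 1 + j) * matpow A j $ a $ b * \<tau> ^ j)"
proof (rule summable_exp_majorant)
  let ?R = "1 + (\<Sum>a\<in>UNIV. \<Sum>b\<in>UNIV. \<bar>A $ a $ b\<bar>)"
  show "0 \<le> ?R" by (auto intro!: add_nonneg_nonneg sum_nonneg)
  fix n
  \<comment> \<open>The ratio of factorials in \<open>Gamma_w\<close> is at most
    \<open>1 / fact n\<close>, because the quotient is a binomial coefficient.\<close>
  have "fact (i + 1) * fact n \<le> (fact (i + 1 + n) :: nat)"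
    by (intro dvd_imp_le fact_fact_dvd_fact) auto
  then have "real (fact (i + 1) * fact n) \<le> real (fact (i + 1 + n))"
    by (simp only: of_nat_le_iff)
  then have "fact (i + 1) * fact n \<le> (fact (i + 1 + n) :: real)"
    by (simp only: of_nat_mult of_nat_fact)
  then have "fact (i + 1) / fact (i + 1 + n) \<le> (1 / fact n :: real)"
    by (simp add: divide_le_eq le_divide_eq mult.commute del: fact_Suc)
  then have "fact (i + 1) / fact (i + 1 + n) * \<bar>matpow A n $ a $ b\<bar> \<le> 1 / fact n * ?R ^ n"
    by (rule mult_mono[OF _ abs_matpow_le]) auto
  then show "\<bar>fact (i + 1) / fact (i + 1 + n) * matpow A n $ a $ b\<bar> \<le> ?R ^ n / fact n"
    by (simp add: abs_mult)
qed

lemma Gamma_w_sums: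
  "(\<lambda>j. (fact (i + 1) / fact (i + 1 + j) * \<tau> ^ j) *\<^sub>R matpow A j) sums Gamma_w A i \<tau>"
  (is "?f sums _")
proof -
  \<comment> \<open>The entrywise sums provide a limit in the space of matrices, so the defining
    series of \<open>Gamma_w\<close> converges to its value.\<close>
  have "?f sums (\<chi> a b. \<Sum>j. ?f j $ a $ b)"
  proof (intro sums_vec)
    fix a b
    show "(\<lambda>j. ?f j $ a $ b) sums (\<chi> a b. \<Sum>j. ?f j $ a $ b) $ a $ b"
      using Gamma_w_summable[of i A a b \<tau>] by (simp add: summable_sums mult_ac)
  qed
  then show ?thesis unfolding Gamma_w_def by (rule summable_sums[OF sums_summable])
qed

lemma Gamma_w_nth:
  "Gamma_w A i \<tau> $ a $ b = (\<Sum>j. fact (i + 1) / fact (i + 1 + j) * matpow A j $ a $ b * \<tau> ^ j)"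
proof -
  have "(\<lambda>j. ((fact (i + 1) / fact (i + 1 + j) * \<tau> ^ j) *\<^sub>R matpow A j) $ a $ b) sums Gamma_w A i \<tau> $ a $ b"
    using tendsto_vec_nth[OF tendsto_vec_nth[OF Gamma_w_sums[of i \<tau> A, unfolded sums_def], of a], of b]
    by (simp add: sums_def del: fact_Suc)
  then show ?thesis by (simp add: sums_iff mult_ac del: fact_Suc)
qed

text \<open>Proved from the power series of the entries: dividing
  \<open>iter_matexp (Suc i) A \<tau>\<close> by the power of \<tau> would break down at \<tau> = 0,
  which belongs to the range of the maximum \<mu>.\<close>

lemma continuous_on_Gamma_w: "continuous_on S (Gamma_w A i)"
proof -
  have "continuous_on S (\<lambda>\<tau>. \<chi> a b. \<Sum>j. fact (i + 1) / fact (i + 1 + j) * matpow A j $ a $ b * \<tau> ^ j)"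
    by (intro continuous_on_vec_lambda continuous_at_imp_continuous_on ballI
        isCont_powser_converges_everywhere[OF Gamma_w_summable])
  also have "(\<lambda>\<tau>. \<chi> a b. \<Sum>j. fact (i + 1) / fact (i + 1 + j) * matpow A j $ a $ b * \<tau> ^ j) = Gamma_w A i"
    by (simp only: fun_eq_iff vec_eq_iff vec_lambda_beta Gamma_w_nth simp_thms)
  finally show ?thesis .
qed

text \<open>The prefactor cancels the numerator \<open>fact (i + 1)\<close> and completes the power
  of \<tau>, so the two series agree term by term.\<close>

lemma scaleR_Gamma_w:
  "(\<tau> ^ (i + 1) / fact (i + 1)) *\<^sub>R Gamma_w A i \<tau> = iter_matexp (Suc i) A \<tau>"
proof (rule sums_unique2)
  show "(\<lambda>j. (\<tau> ^ (Suc i + j) / fact (Suc i + j)) *\<^sub>R matpow A j) sums iter_matexp (Suc i) A \<tau>"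
    by (rule iter_matexp_sums)
  show "(\<lambda>j. (\<tau> ^ (Suc i + j) / fact (Suc i + j)) *\<^sub>R matpow A j) sums
      ((\<tau> ^ (i + 1) / fact (i + 1)) *\<^sub>R Gamma_w A i \<tau>)"
    using sums_scaleR_right[OF Gamma_w_sums, of "\<tau> ^ (i + 1) / fact (i + 1)" i \<tau> A]
    by (simp add: power_add mult_ac del: fact_Suc)
qed

section \<open>The augmented state\<close>

lemma sum_UNIV_Plus:
  fixes f :: "'a::finite + 'b::finite \<Rightarrow> 'c::comm_monoid_add"
  shows "(\<Sum>i\<in>UNIV. f i) = (\<Sum>a\<in>UNIV. f (Inl a)) + (\<Sum>b\<in>UNIV. f (Inr b))"
  using sum.Plus[of "UNIV :: 'a set" "UNIV :: 'b set" f] by (simp add: comp_def)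

lemma sum_UNIV_Times:
  fixes f :: "'a::finite \<times> 'b::finite \<Rightarrow> 'c::comm_monoid_add"
  shows "(\<Sum>i\<in>UNIV. f i) = (\<Sum>a\<in>UNIV. \<Sum>b\<in>UNIV. f (a, b))"
  using sum.cartesian_product[of "\<lambda>a b. f (a, b)" "UNIV :: 'b set" "UNIV :: 'a set"] by simp

lemma pos_less: "pos (k :: 'k::{finite,linorder}) < CARD('k)"
  unfolding pos_def by (rule psubset_card_mono) auto

text \<open>\<open>pos\<close> is strictly increasing, hence injective, and an injection into a set
  of the same finite size is onto. Sums over block indices thus become sums over an initial segment
  of the naturals, which can telescope.\<close>

lemma bij_betw_pos: "bij_betw (pos :: 'k::{finite,linorder} \<Rightarrow> nat) UNIV {..<CARD('k)}"
proof -
  have "inj (pos :: 'k \<Rightarrow> nat)"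
  proof (rule linorder_injI)
    fix i j :: 'k assume "i < j"
    then have "pos i < pos j"
      unfolding pos_def by (intro psubset_card_mono) auto
    then show "pos i \<noteq> pos j" by simp
  qed
  moreover have "pos ` (UNIV :: 'k set) = {..<CARD('k)}"
    using calculation by (intro card_subset_eq) (auto simp: pos_less card_image)
  ultimately show ?thesis by (simp add: bij_betw_def)
qed

lemma sum_pos: "(\<Sum>k\<in>(UNIV :: 'k::{finite,linorder} set). f (pos k)) = sum f {..<CARD('k)}"
  by (rule sum.reindex_bij_betw[OF bij_betw_pos])

text \<open>Evaluates a selector row against the stacked vector. It serves \<open>Pi_first\<close>
  with \<open>n = 0\<close> and \<open>Psi\<close> with \<open>n\<close> one past the current block;
  the zero case is the last block row of \<open>Psi\<close>.\<close>

lemma sum_if_pos: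
  fixes f :: "'q::finite \<Rightarrow> nat \<Rightarrow> real"
  shows "(\<Sum>j\<in>(UNIV :: ('k::{finite,linorder} \<times> 'q) set).
      (if pos (fst j) = n \<and> snd j = b then 1 else 0) * f (snd j) (pos (fst j))) =
    (if n < CARD('k) then f b n else 0)"
proof -
  have "(\<Sum>j\<in>(UNIV :: ('k \<times> 'q) set).
      (if pos (fst j) = n \<and> snd j = b then 1 else 0) * f (snd j) (pos (fst j))) =
      (\<Sum>k\<in>(UNIV :: 'k set). if pos k = n then f b n else 0)"
    unfolding sum_UNIV_Times by (intro sum.cong) (auto simp: if_distrib[of "\<lambda>c. c * _"] cong: if_cong)
  also have "\<dots> = (\<Sum>i<CARD('k). if i = n then f b n else 0)"
    by (rule sum_pos)
  finally show ?thesis by simp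
qed

lemma eta_nth [simp]:
  "eta x w t $ Inl a = x t $ a"
  "eta x w t $ Inr (k, b) = nderiv (pos k) w t $ b"
  by (simp_all add: eta_def)

lemma eta_nth_Inr: "eta x w t $ Inr j = nderiv (pos (fst j)) w t $ snd j"
  by (cases j) simp

lemma nderiv_0 [simp]: "nderiv 0 w = w"
  by (simp add: nderiv_def)

lemma block_mult_eta:
  fixes M :: "real^'n^'a" and N :: "real^('k::{finite,linorder} \<times> 'q::finite)^'a"
  shows "(hblock M N *v eta x w t) $ i =
    (M *v x t) $ i + (\<Sum>j\<in>UNIV. N $ i $ j * nderiv (pos (fst j)) w t $ snd j)"
  by (simp add: matrix_vector_mult_def hblock_def sum_UNIV_Plus eta_nth_Inr)

lemma Pi_first_mult_eta:
  fixes D :: "real^'q^'a"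
  shows "(\<Sum>j\<in>UNIV. (D ** (Pi_first :: real^('k::{finite,linorder} \<times> 'q)^'q)) $ i $ j *
      nderiv (pos (fst j)) w t $ snd j) = (D *v w t) $ i"
proof -
  have "(\<Sum>j\<in>UNIV. (D ** (Pi_first :: real^('k \<times> 'q)^'q)) $ i $ j * nderiv (pos (fst j)) w t $ snd j) =
      (\<Sum>b\<in>UNIV. D $ i $ b * (\<Sum>j\<in>(UNIV :: ('k \<times> 'q) set).
        (if pos (fst j) = 0 \<and> snd j = b then 1 else 0) * nderiv (pos (fst j)) w t $ snd j))"
    unfolding matrix_matrix_mult_def Pi_first_def sum_distrib_left
    by (simp add: sum_distrib_right mult.assoc) (rule sum.swap)
  also have "\<dots> = (D *v w t) $ i"
    by (simp add: sum_if_pos[where f = "\<lambda>b i. nderiv i w t $ b"] matrix_vector_mult_def)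
  finally show ?thesis .
qed

text \<open>The measured output is a linear function of the augmented state, which closes the
  equation of the observer error.\<close>

lemma C_bar_mult_eta:
  "C_bar Cx Dw *v (eta x w t :: real^('n::finite + 'k::{finite,linorder} \<times> 'q::finite)) = Cx *v x t + Dw *v w t"
  by (simp add: vec_eq_iff C_bar_def block_mult_eta Pi_first_mult_eta)

text \<open>The right-hand side is the predictor at the start of the horizon, written out for
  \<open>CARD('k)\<close> disturbance terms.\<close>

lemma K_mat_mult_eta:
  "K_mat A Bw T *v (eta x w t :: real^('n::finite + 'k::{finite,linorder} \<times> 'q::finite)) =
    iter_matexp 0 A T *v x t + (\<Sum>i<CARD('k). iter_matexp (Suc i) A T *v (Bw *v nderiv i w t))"
proof -
  have row: "Gamma_w_row A Bw T $ a $ j = (iter_matexp (Suc (pos (fst j))) A T ** Bw) $ a $ snd j"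
    for a and j :: "'k \<times> 'q"
    unfolding Gamma_w_row_def scaleR_Gamma_w[symmetric]
    by (simp add: matrix_matrix_mult_def sum_distrib_left mult.assoc)
  have "(\<Sum>j\<in>(UNIV :: ('k \<times> 'q) set). Gamma_w_row A Bw T $ a $ j * nderiv (pos (fst j)) w t $ snd j) =
      (\<Sum>i<CARD('k). ((iter_matexp (Suc i) A T ** Bw) *v nderiv i w t) $ a)" for a
    unfolding sum_UNIV_Times row sum_pos[symmetric] by (simp add: matrix_vector_mult_def)
  then show ?thesis
    by (simp add: vec_eq_iff K_mat_def matexp_scaleR block_mult_eta matrix_vector_mul_assoc)
qed

section \<open>Differentiating the disturbance and the augmented state\<close>

lemma nderiv_has_vector_derivative:
  assumes "times_cont_diff n w" "i < n"
  shows "(nderiv i w has_vector_derivative nderiv (Suc i) w t) (at t)"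
  using assms by (simp add: times_cont_diff_def nderiv_def vector_derivative_works)

lemma continuous_on_nderiv:
  assumes "times_cont_diff n w" "i \<le> n"
  shows "continuous_on S (nderiv i w)"
proof (cases "i = n")
  case True
  then show ?thesis using assms by (auto simp: times_cont_diff_def intro: continuous_on_subset)
next
  case False
  then show ?thesis
    using assms(2)
    by (intro continuous_at_imp_continuous_on ballI
        has_vector_derivative_continuous[OF nderiv_has_vector_derivative[OF assms(1)]]) simp
qed

text \<open>The disturbance and its derivatives form a chain of integrators: each block is the
  derivative of the preceding one, and the chain is driven from its end by the highest
  derivative.\<close>

lemma eta_has_vector_derivative:
  fixes x :: "real \<Rightarrow> real^'n" and w :: "real \<Rightarrow> real^'q"
  defines "z \<equiv> eta x w :: real \<Rightarrow> real^('n + 'k::{finite,linorder} \<times> 'q)"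
  assumes w: "times_cont_diff (CARD('k)) w"
    and x: "(x has_vector_derivative A *v x t + v + Bw *v w t) (at t)"
    and v: "v = Bu *v u"
  shows "(z has_vector_derivative A_bar A Bw *v z t + Bu_bar Bu *v u + Bw_bar *v nderiv (CARD('k)) w t) (at t)"
proof (rule has_vector_derivative_vec)
  fix i :: "'n + 'k \<times> 'q"
  show "((\<lambda>t. z t $ i) has_vector_derivative
      (A_bar A Bw *v z t + Bu_bar Bu *v u + Bw_bar *v nderiv (CARD('k)) w t) $ i) (at t)"
  proof (cases i)
    case (Inl a)
    have "(A_bar A Bw *v z t) $ Inl a = (hblock A (Bw ** Pi_first) *v z t) $ a"
      by (simp add: A_bar_def block_def vblock_def matrix_vector_mult_def)
    moreover have "(Bu_bar Bu *v u) $ (Inl a :: 'n + 'k \<times> 'q) = v $ a"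
      by (simp add: v Bu_bar_def vblock_def matrix_vector_mult_def)
    moreover have "(Bw_bar *v nderiv (CARD('k)) w t) $ (Inl a :: 'n + 'k \<times> 'q) = 0"
      by (simp add: Bw_bar_def vblock_def matrix_vector_mult_def)
    ultimately show ?thesis
      using bounded_linear.has_vector_derivative[OF bounded_linear_vec_nth x, of a]
      by (simp add: Inl z_def block_mult_eta Pi_first_mult_eta algebra_simps)
  next
    case (Inr j)
    obtain k b where j: "j = (k, b)" by (cases j)
    have "(A_bar A Bw *v z t) $ Inr j = (hblock 0 Psi *v z t) $ j"
      by (simp add: A_bar_def block_def vblock_def matrix_vector_mult_def)
    also have "\<dots> = (\<Sum>i\<in>(UNIV :: ('k \<times> 'q) set). (if pos (fst i) = Suc (pos k) \<and> snd i = b then 1 else 0) *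
        nderiv (pos (fst i)) w t $ snd i)"
      by (simp add: z_def block_mult_eta Psi_def j)
    also have "\<dots> = (if Suc (pos k) < CARD('k) then nderiv (Suc (pos k)) w t $ b else 0)"
      by (rule sum_if_pos)
    finally have "(A_bar A Bw *v z t) $ Inr j = (if Suc (pos k) < CARD('k) then nderiv (Suc (pos k)) w t $ b else 0)" .
    moreover have "(Bu_bar Bu *v u) $ (Inr j :: 'n + 'k \<times> 'q) = 0"
      by (simp add: Bu_bar_def vblock_def matrix_vector_mult_def)
    moreover have "(Bw_bar *v nderiv (CARD('k)) w t) $ (Inr j :: 'n + 'k \<times> 'q) =
        (if Suc (pos k) = CARD('k) then nderiv (CARD('k)) w t $ b else 0)"
      by (simp add: Bw_bar_def vblock_def matrix_vector_mult_def j if_distrib[of "\<lambda>c. c * _"] cong: if_cong)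
    \<comment> \<open>Below the last block \<open>Psi\<close> supplies the next derivative; at the
      last block \<open>Psi\<close> gives zero and \<open>Bw_bar\<close> supplies it.\<close>
    moreover have "Suc (pos k) < CARD('k) \<or> Suc (pos k) = CARD('k)"
      using pos_less[of k] by linarith
    ultimately show ?thesis
      using bounded_linear.has_vector_derivative[OF bounded_linear_vec_nth
          nderiv_has_vector_derivative[OF w pos_less[of k]], of b t]
      by (auto simp: Inr j z_def)
  qed
qed

lemma continuous_on_eta:
  assumes "continuous_on S x" "times_cont_diff (CARD('k)) w"
  shows "continuous_on S (eta x w :: real \<Rightarrow> real^('n::finite + 'k::{finite,linorder} \<times> 'q::finite))"
proof -
  have "continuous_on S (\<lambda>t. (eta x w t :: real^('n + 'k \<times> 'q)) $ i)" for i
    using assms continuous_on_nderiv[OF assms(2) less_imp_le[OF pos_less]]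
    by (cases i) (auto simp: eta_nth_Inr intro: continuous_on_component)
  then have "continuous_on S (\<lambda>t. \<chi> i. (eta x w t :: real^('n + 'k \<times> 'q)) $ i)"
    by (intro continuous_on_vec_lambda)
  then show ?thesis by simp
qed

section \<open>The prediction identity\<close>

lemmas has_vector_derivative_matrix_vector_mult =
  bounded_bilinear.has_vector_derivative[OF bounded_bilinear_matrix_vector_mult]

lemmas continuous_on_matrix_vector_mult =
  bounded_bilinear.continuous_on[OF bounded_bilinear_matrix_vector_mult]

lemma minus_matrix_vector_mult: "- M *v v = - (M *v v)" for M :: "real^'n^'m"
  using bounded_bilinear.minus_left[OF bounded_bilinear_matrix_vector_mult] .

lemma bounded_linear_matrix_mult_left:
  fixes B :: "real^'k^'n"
  shows "bounded_linear (\<lambda>M :: real^'n^'m. M ** B)"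
  unfolding linear_conv_bounded_linear[symmetric]
  by (auto intro!: linearI
      simp: vec_eq_iff matrix_matrix_mult_def sum.distrib sum_distrib_left distrib_right mult.assoc)

lemma has_vector_derivative_reflect:
  assumes "(f has_vector_derivative f') (at (c - s))"
  shows "((\<lambda>s. f (c - s)) has_vector_derivative - f') (at s)"
proof -
  have "((\<lambda>s. c - s) has_vector_derivative - 1) (at s)"
    by (auto intro!: derivative_eq_intros)
  from vector_diff_chain_at[OF this assms] show ?thesis by (simp add: comp_def)
qed

text \<open>Taking \<open>\<Phi>(c - s) x(s)\<close> removes the plant dynamics; the remaining terms are the successive
  integrations by parts of the disturbance, so that only its last derivative survives.\<close>

definition predictor ::
  "real^'n^'n \<Rightarrow> real^'q^'n \<Rightarrow> nat \<Rightarrow> (real \<Rightarrow> real^'n) \<Rightarrow> (real \<Rightarrow> real^'q) \<Rightarrow> real \<Rightarrow> real \<Rightarrow> real^'n" where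
  "predictor A Bw r x w c s = iter_matexp 0 A (c - s) *v x s +
     (\<Sum>i<Suc r. iter_matexp (Suc i) A (c - s) *v (Bw *v nderiv i w s))"

lemma predictor_has_vector_derivative:
  assumes w: "times_cont_diff (Suc r) w"
    and x: "(x has_vector_derivative A *v x s + v + Bw *v w s) (at s)"
  shows "(predictor A Bw r x w c has_vector_derivative
    iter_matexp 0 A (c - s) *v v + iter_matexp (Suc r) A (c - s) *v (Bw *v nderiv (Suc r) w s)) (at s)"
proof -
  let ?M = "\<lambda>i. iter_matexp i A (c - s)" and ?w = "\<lambda>i. Bw *v nderiv i w s"
  have dx: "((\<lambda>s. iter_matexp 0 A (c - s) *v x s) has_vector_derivative
      ?M 0 *v (A *v x s + v + Bw *v w s) + - (?M 0 ** A) *v x s) (at s)"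
    by (intro has_vector_derivative_matrix_vector_mult has_vector_derivative_reflect
        iter_matexp_0_has_vector_derivative x)
  have dw: "((\<lambda>s. iter_matexp (Suc i) A (c - s) *v (Bw *v nderiv i w s)) has_vector_derivative
      ?M (Suc i) *v ?w (Suc i) + - ?M i *v ?w i) (at s)" if "i < Suc r" for i
    using that w
    by (intro has_vector_derivative_matrix_vector_mult has_vector_derivative_reflect
        iter_matexp_Suc_has_vector_derivative nderiv_has_vector_derivative
        bounded_linear.has_vector_derivative[OF matrix_vector_mul_bounded_linear])
  have "(predictor A Bw r x w c has_vector_derivative
      (?M 0 *v (A *v x s + v + Bw *v w s) + - (?M 0 ** A) *v x s) +
      (\<Sum>i<Suc r. ?M (Suc i) *v ?w (Suc i) + - ?M i *v ?w i)) (at s)"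
    unfolding predictor_def
    by (intro has_vector_derivative_add dx has_vector_derivative_sum dw) simp
  \<comment> \<open>The lower end of the telescoped sum cancels the disturbance in the plant
    equation, just as the derivative of \<Phi> cancels the term \<open>A *v x s\<close>.\<close>
  also have "(\<Sum>i<Suc r. ?M (Suc i) *v ?w (Suc i) + - ?M i *v ?w i) = ?M (Suc r) *v ?w (Suc r) - ?M 0 *v ?w 0"
    unfolding minus_matrix_vector_mult add_uminus_conv_diff
    by (rule sum_lessThan_telescope[of "\<lambda>i. ?M i *v ?w i"])
  finally show ?thesis
    by (simp add: minus_matrix_vector_mult matrix_vector_right_distrib matrix_vector_mul_assoc)
qed

lemma continuous_on_iter_matexp_mult:
  assumes "continuous_on S v"
  shows "continuous_on S (\<lambda>s. iter_matexp i A (c - s) *v v s)"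
  by (intro continuous_on_matrix_vector_mult assms continuous_on_compose2[OF continuous_on_iter_matexp[of UNIV]]
      continuous_intros) auto

lemma continuous_on_mult_nderiv:
  fixes B :: "real^'q^'n"
  assumes "times_cont_diff n w" "i \<le> n"
  shows "continuous_on S (\<lambda>s. B *v nderiv i w s)"
  by (rule bounded_linear.continuous_on[OF matrix_vector_mul_bounded_linear continuous_on_nderiv[OF assms]])

lemma continuous_on_predictor:
  assumes "continuous_on S x" "times_cont_diff (Suc r) w"
  shows "continuous_on S (predictor A Bw r x w c)"
  unfolding predictor_def
  by (intro continuous_on_add continuous_on_sum continuous_on_iter_matexp_mult assms(1)
      continuous_on_mult_nderiv[OF assms(2)]) auto

lemma O_r_integrand:
  "(\<tau> ^ (r + 1) / fact (r + 1)) *\<^sub>R (Gamma_w A r \<tau> ** Bw *v v) = iter_matexp (Suc r) A \<tau> *v (Bw *v v)"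
  unfolding scaleR_Gamma_w[symmetric] matrix_vector_mul_assoc scaleR_matrix_vector_assoc
    linear_cmul[OF bounded_linear.linear, OF bounded_linear_matrix_mult_left] ..

lemma O_r_eq:
  "O_r A Bw r w T t = integral {t..t + T} (\<lambda>s. iter_matexp (Suc r) A (t + T - s) *v (Bw *v nderiv (Suc r) w s))"
  unfolding O_r_def O_r_integrand by simp

lemma Gamma_u_mult:
  "Gamma_u A Bu c a b *v v = integral {a..b} (\<lambda>s. iter_matexp 0 A (c - s) *v (Bu *v v))"
proof -
  have "continuous_on {a..b} (\<lambda>s. iter_matexp 0 A (c - s) ** Bu)"
    by (intro bounded_linear.continuous_on[OF bounded_linear_matrix_mult_left]
        continuous_on_compose2[OF continuous_on_iter_matexp[of UNIV]] continuous_intros) auto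
  then have "(\<lambda>s. iter_matexp 0 A (c - s) ** Bu) integrable_on {a..b}"
    by (rule integrable_continuous_interval)
  from integral_linear[OF this bounded_bilinear.bounded_linear_left[OF bounded_bilinear_matrix_vector_mult, of v]]
  show ?thesis
    by (simp add: Gamma_u_def matexp_scaleR comp_def matrix_vector_mul_assoc)
qed

section \<open>Increment of the predictor over the horizon\<close>

lemma finite_shifted_jumps:
  assumes "piecewise_constant u (t0 - h)"
  shows "finite ({t. t - h \<in> jumps u (t0 - h)} \<inter> {a..b})"
proof (rule finite_subset)
  show "{t. t - h \<in> jumps u (t0 - h)} \<inter> {a..b} \<subseteq> (\<lambda>s. s + h) ` (jumps u (t0 - h) \<inter> {t0 - h..b - h})"
    by (auto simp: jumps_def intro!: image_eqI[where x = "t - h" for t])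
  show "finite ((\<lambda>s. s + h) ` (jumps u (t0 - h) \<inter> {t0 - h..b - h}))"
    using assms by (simp add: piecewise_constant_def)
qed

lemma solves_off_has_vector_derivative:
  assumes "solves_off z f t0 J" "t0 < t" "t \<notin> J"
  shows "(z has_vector_derivative f t (z t)) (at t)"
proof -
  have "at t within {t0..} = at t"
    using assms(2) by (intro at_within_open_subset[of t "{t0<..}"]) auto
  moreover have "(z has_vector_derivative f t (z t)) (at t within {t0..})"
    using assms unfolding solves_off_def by simp
  ultimately show ?thesis by simp
qed

lemma predictor_increment:
  fixes A :: "real^'n^'n" and Bu :: "real^'m^'n" and Bw :: "real^'q^'n"
  assumes plant: "solves_off x (\<lambda>t z. A *v z + Bu *v u (t - h) + Bw *v w t)
        t0 {t. t - h \<in> jumps u (t0 - h)}"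
    and w: "times_cont_diff (r + 1) w"
    and u: "piecewise_constant u (t0 - h)"
    and t: "t0 \<le> t" and part: "input_partition u h T t N tk uk"
  shows "x (t + T) - predictor A Bw r x w (t + T) t = Gamma_u_times A Bu h T t N tk uk + O_r A Bw r w T t"
proof -
  define c where "c = t + T"
  define J where "J = {t. t - h \<in> jumps u (t0 - h)}"
  \<comment> \<open>The switching instants shifted by the delay, with \<open>t\<close> put in front.
    The value \<open>c\<close> beyond \<open>N\<close> closes the last piece and keeps the sequence
    monotone.\<close>
  define a where "a k = (if k = 0 then t else if k \<le> N then tk k + h else c)" for k
  define R where "R s = iter_matexp (Suc r) A (c - s) *v (Bw *v nderiv (Suc r) w s)" for s
  \<comment> \<open>Subtracting the accumulated remainder leaves the input as the only contribution
    to the derivative.\<close>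
  define Q where "Q s = predictor A Bw r x w c s - integral {t..s} R" for s
  have w': "times_cont_diff (Suc r) w" using w by simp
  have p: "1 \<le> N" "t - h < tk 1" "tk N < t + T - h"
    "\<And>k. k \<in> {1..<N} \<Longrightarrow> tk k < tk (Suc k)"
    "\<And>s. s \<in> {t - h..<tk 1} \<Longrightarrow> u s = uk 0"
    "\<And>k s. k \<in> {1..<N} \<Longrightarrow> s \<in> {tk k..<tk (Suc k)} \<Longrightarrow> u s = uk k"
    "\<And>s. s \<in> {tk N..t + T - h} \<Longrightarrow> u s = uk N"
    using part unfolding input_partition_def by auto
  have step: "a k \<le> a (Suc k)" for k
  proof -
    consider "k = 0" | "k \<in> {1..<N}" | "k = N" | "k > N" by force
    then show ?thesis using p(1-3) p(4)[of k] by cases (auto simp: a_def c_def)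
  qed
  then have mono: "mono a" by (rule incseq_SucI)
  have a0: "a 0 = t" and aN: "a (Suc N) = c" using p(1) by (auto simp: a_def)
  have contR: "continuous_on S R" for S
    unfolding R_def by (intro continuous_on_iter_matexp_mult continuous_on_mult_nderiv[OF w']) simp
  have contx: "continuous_on {t..c} x"
    using plant t unfolding solves_off_def by (auto intro: continuous_on_subset)
  have contQ: "continuous_on {t..c} Q"
    unfolding Q_def
    by (intro continuous_on_diff continuous_on_predictor contx w'
        indefinite_integral_continuous_1 integrable_continuous_interval contR)
  have derQ: "(Q has_vector_derivative iter_matexp 0 A (c - s) *v (Bu *v u (s - h))) (at s)"
    if "t < s" "s < c" "s \<notin> J" for s
  proof -
    have "(x has_vector_derivative A *v x s + Bu *v u (s - h) + Bw *v w s) (at s)"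
      using solves_off_has_vector_derivative[OF plant, of s] that t by (simp add: J_def)
    then have "(predictor A Bw r x w c has_vector_derivative
        iter_matexp 0 A (c - s) *v (Bu *v u (s - h)) + R s) (at s)"
      unfolding R_def by (rule predictor_has_vector_derivative[OF w'])
    moreover have "((\<lambda>s. integral {t..s} R) has_vector_derivative R s) (at s)"
    proof -
      have "at s within {t..c} = at s"
        using that by (intro at_within_interior) simp
      then show ?thesis
        using integral_has_vector_derivative[OF contR[of "{t..c}"], of s] that by simp
    qed
    ultimately show ?thesis
      unfolding Q_def by (rule has_vector_derivative_diff[THEN has_vector_derivative_eq_rhs]) simp
  qed
  have piece: "Q (a (Suc k)) - Q (a k) = Gamma_u A Bu c (a k) (a (Suc k)) *v uk k" if k: "k \<le> N" for k
  proof -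
    have sub: "t \<le> a k" "a (Suc k) \<le> c"
      using monoD[OF mono, of 0 k] monoD[OF mono, of "Suc k" "Suc N"] k a0 aN by auto
    \<comment> \<open>On the open piece the delayed input has one value, so the integrand agrees
      with that of \<open>Gamma_u\<close> applied to \<open>uk k\<close>.\<close>
    have const: "u (s - h) = uk k" if "a k < s" "s < a (Suc k)" for s
    proof -
      consider "k = 0" | "k \<in> {1..<N}" | "k = N" "k \<noteq> 0" using k by force
      then show ?thesis
        using that p(1) p(5)[of "s - h"] p(6)[of k "s - h"] p(7)[of "s - h"]
        by cases (auto simp: a_def c_def)
    qed
    \<comment> \<open>The fundamental theorem of calculus in its form with a finite exceptional set:
      \<open>Q\<close> is continuous throughout, and its derivative is known off
      \<open>J\<close>.\<close>
    have "((\<lambda>s. iter_matexp 0 A (c - s) *v (Bu *v uk k)) has_integral (Q (a (Suc k)) - Q (a k))) {a k..a (Suc k)}"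
    proof (rule fundamental_theorem_of_calculus_interior_strong)
      show "finite (J \<inter> {a k..a (Suc k)})"
        unfolding J_def by (rule finite_shifted_jumps[OF u])
      show "continuous_on {a k..a (Suc k)} Q"
        using sub by (intro continuous_on_subset[OF contQ]) auto
      show "(Q has_vector_derivative iter_matexp 0 A (c - s) *v (Bu *v uk k)) (at s)"
        if "s \<in> {a k<..<a (Suc k)} - J \<inter> {a k..a (Suc k)}" for s
        using derQ[of s] const[of s] that sub by auto
    qed (rule step)
    then show ?thesis by (simp add: Gamma_u_mult integral_unique)
  qed
  have "Gamma_u_times A Bu h T t N tk uk = (\<Sum>k\<le>N. Gamma_u A Bu c (a k) (a (Suc k)) *v uk k)"
    unfolding Gamma_u_times_def by (rule sum.cong) (use p(1) in \<open>auto simp: a_def c_def\<close>)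
  \<comment> \<open>The \<open>N + 1\<close> pieces adjoin one another, so their increments
    telescope over the whole horizon.\<close>
  also have "\<dots> = (\<Sum>k<Suc N. Q (a (Suc k)) - Q (a k))"
    by (simp add: piece lessThan_Suc_atMost)
  also have "\<dots> = Q c - Q t"
    using sum_lessThan_telescope[of "\<lambda>k. Q (a k)" "Suc N"] a0 aN by simp
  finally have *: "Gamma_u_times A Bu h T t N tk uk = Q c - Q t" .
  have "predictor A Bw r x w c c = x c"
    by (simp add: predictor_def iter_matexp_at_0 del: sum.lessThan_Suc)
  moreover have "integral {t..c} R = O_r A Bw r w T t"
    by (simp add: O_r_eq R_def[abs_def] c_def)
  ultimately show ?thesis
    using * by (simp add: Q_def c_def)
qed

section \<open>Size of the remainder integral\<close>

lemma norm_O_r_le: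
  fixes A :: "real^'n^'n" and Bw :: "real^'q^'n"
  assumes "0 \<le> T" "times_cont_diff (r + 1) w" "\<And>s. norm (nderiv (r + 1) w s) \<le> \<epsilon>"
    and \<mu>: "\<And>s. s \<in> {t..t + T} \<Longrightarrow> onorm ((*v) (Gamma_w A r (t + T - s) ** Bw)) \<le> \<mu>"
  shows "norm (O_r A Bw r w T t) \<le> T ^ (r + 2) / fact (r + 2) * \<mu> * \<epsilon>"
proof -
  define c where "c = t + T"
  have w: "times_cont_diff (Suc r) w" using assms(2) by simp
  \<comment> \<open>Chosen so that \<open>k * (c - s) ^ (r + 2)\<close> is an antiderivative of the
    scalar majorant; the sign comes from the inner derivative -1.\<close>
  define k where "k = - (\<mu> * \<epsilon>) / fact (r + 2)"
  have "((\<lambda>s. (c - s) ^ (r + 1) / fact (r + 1) * (\<mu> * \<epsilon>)) has_integral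
      (k * (c - c) ^ (r + 2) - k * (c - t) ^ (r + 2))) {t..c}"
  proof (rule fundamental_theorem_of_calculus)
    show "t \<le> c" using assms(1) by (simp add: c_def)
    fix s
    have "((\<lambda>s. c - s) has_real_derivative - 1) (at s within {t..c})"
      by (auto intro!: derivative_eq_intros)
    from DERIV_cmult[OF DERIV_power[OF this, of "r + 2"], of k]
    have "((\<lambda>s. k * (c - s) ^ (r + 2)) has_real_derivative
        k * (real (r + 2) * (- 1 * (c - s) ^ (r + 1)))) (at s within {t..c})"
      by simp
    also have "k * (real (r + 2) * (- 1 * (c - s) ^ (r + 1))) = (c - s) ^ (r + 1) / fact (r + 1) * (\<mu> * \<epsilon>)"
      using fact_Suc[of "r + 1", where ?'a = real]
      by (simp add: k_def field_simps del: fact_Suc of_nat_Suc power_Suc)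
    finally show "((\<lambda>s. k * (c - s) ^ (r + 2)) has_vector_derivative
        (c - s) ^ (r + 1) / fact (r + 1) * (\<mu> * \<epsilon>)) (at s within {t..c})"
      by (simp add: has_real_derivative_iff_has_vector_derivative)
  qed
  then have int: "((\<lambda>s. (c - s) ^ (r + 1) / fact (r + 1) * (\<mu> * \<epsilon>)) has_integral
      T ^ (r + 2) / fact (r + 2) * \<mu> * \<epsilon>) {t..c}"
    by (simp add: c_def k_def mult_ac)
  have "norm (O_r A Bw r w T t) \<le> integral {t..c} (\<lambda>s. (c - s) ^ (r + 1) / fact (r + 1) * (\<mu> * \<epsilon>))"
    unfolding O_r_def c_def[symmetric]
  proof (rule integral_norm_bound_integral)
    show "(\<lambda>s. (c - s) ^ (r + 1) / fact (r + 1) * (\<mu> * \<epsilon>)) integrable_on {t..c}"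
      using int by blast
    show "(\<lambda>s. ((c - s) ^ (r + 1) / fact (r + 1)) *\<^sub>R (Gamma_w A r (c - s) ** Bw *v nderiv (r + 1) w s))
        integrable_on {t..c}"
      unfolding O_r_integrand
      by (auto intro!: integrable_continuous_interval continuous_on_iter_matexp_mult continuous_on_mult_nderiv[OF w])
    fix s assume s: "s \<in> {t..c}"
    let ?G = "Gamma_w A r (c - s) ** Bw"
    have "norm (?G *v nderiv (r + 1) w s) \<le> onorm ((*v) ?G) * norm (nderiv (r + 1) w s)"
      by (rule onorm) simp
    \<comment> \<open>That \<mu> is nonnegative follows because it dominates an operator
      norm.\<close>
    also have "\<dots> \<le> \<mu> * \<epsilon>"
      using \<mu>[of s] s onorm_pos_le[OF matrix_vector_mul_bounded_linear, of ?G]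
      by (intro mult_mono assms(3)) (auto simp: c_def)
    finally have "norm (?G *v nderiv (r + 1) w s) \<le> \<mu> * \<epsilon>" .
    then have "(c - s) ^ (r + 1) / fact (r + 1) * norm (?G *v nderiv (r + 1) w s) \<le>
        (c - s) ^ (r + 1) / fact (r + 1) * (\<mu> * \<epsilon>)"
      using s by (intro mult_left_mono) auto
    moreover have "0 \<le> (c - s) ^ (r + 1) / fact (r + 1)"
      using s by simp
    ultimately show "norm (((c - s) ^ (r + 1) / fact (r + 1)) *\<^sub>R (?G *v nderiv (r + 1) w s)) \<le>
        (c - s) ^ (r + 1) / fact (r + 1) * (\<mu> * \<epsilon>)"
      unfolding norm_scaleR by (simp only: abs_of_nonneg)
  qed
  then show ?thesis unfolding integral_unique[OF int] .
qed

text \<open>The reverse triangle inequality for the operator norm.\<close>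

lemma abs_onorm_diff_le:
  fixes f g :: "'a::real_normed_vector \<Rightarrow> 'b::real_normed_vector"
  assumes "bounded_linear f" "bounded_linear g"
  shows "\<bar>onorm f - onorm g\<bar> \<le> onorm (\<lambda>x. f x - g x)"
proof -
  have "onorm f \<le> onorm (\<lambda>x. f x - g x) + onorm g" if "bounded_linear f" "bounded_linear g"
    for f g :: "'a \<Rightarrow> 'b"
    using onorm_triangle[OF bounded_linear_sub[OF that] that(2)] by simp
  from this[OF assms] this[OF assms(2,1)] show ?thesis
    using onorm_neg[of "\<lambda>x. f x - g x"] by (simp add: fun_Compl_def)
qed

text \<open>The operator norm is Lipschitz in the matrix: it satisfies the reverse triangle
  inequality and is bounded by a multiple of the norm of the matrix as a vector of entries.\<close>

lemma continuous_on_onorm_matrix: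
  fixes f :: "'a::topological_space \<Rightarrow> real^'n^'m"
  assumes "continuous_on S f"
  shows "continuous_on S (\<lambda>s. onorm ((*v) (f s)))"
proof -
  obtain C where C: "\<And>M v. norm (M *v v :: real^'m) \<le> norm M * norm (v :: real^'n) * C" "0 < C"
    using bounded_bilinear.pos_bounded[OF bounded_bilinear_matrix_vector_mult] by metis
  have "dist (onorm ((*v) M)) (onorm ((*v) N)) \<le> C * dist M N" for M N :: "real^'n^'m"
  proof -
    have "dist (onorm ((*v) M)) (onorm ((*v) N)) \<le> onorm ((*v) (M - N))"
      unfolding dist_real_def matrix_vector_mult_diff_rdistrib[abs_def]
      by (rule abs_onorm_diff_le) simp_all
    also have "\<dots> \<le> C * dist M N"
      using C by (intro onorm_bound) (auto simp: dist_norm mult_ac)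
    finally show ?thesis .
  qed
  then have "C-lipschitz_on UNIV (\<lambda>M :: real^'n^'m. onorm ((*v) M))"
    using C by (intro lipschitz_onI) auto
  then show ?thesis
    by (rule continuous_on_compose2[OF lipschitz_on_continuous_on _ ]) (use assms in auto)
qed

text \<open>A continuous function attains its supremum on a compact interval, so \<mu> is a genuine
  maximum.\<close>

lemma max_onorm_Gamma_w:
  fixes A :: "real^'n^'n" and Bw :: "real^'q^'n"
  assumes "0 \<le> T"
  shows "\<exists>s\<in>{t..t + T}. \<forall>s'\<in>{t..t + T}.
    onorm ((*v) (Gamma_w A r (t + T - s') ** Bw)) \<le> onorm ((*v) (Gamma_w A r (t + T - s) ** Bw))"
proof (rule continuous_attains_sup)
  show "continuous_on {t..t + T} (\<lambda>s. onorm ((*v) (Gamma_w A r (t + T - s) ** Bw)))"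
    by (intro continuous_on_onorm_matrix bounded_linear.continuous_on[OF bounded_linear_matrix_mult_left]
        continuous_on_compose2[OF continuous_on_Gamma_w[of UNIV]] continuous_intros) auto
qed (use assms in auto)

section \<open>Ultimate bound for the observer error\<close>

text \<open>The increment of \<open>g\<close> is the integral of its derivative, since continuity
  bridges the finitely many exceptional points.\<close>

lemma nonincreasing_off_finite:
  fixes g g' :: "real \<Rightarrow> real"
  assumes "finite S" "a \<le> b" "continuous_on {a..b} g"
    and "\<And>t. t \<in> {a<..<b} - S \<Longrightarrow> (g has_real_derivative g' t) (at t)"
    and "\<And>t. t \<in> {a<..<b} - S \<Longrightarrow> g' t \<le> 0"
  shows "g b \<le> g a"
proof -
  have "(g' has_integral (g b - g a)) {a..b}"
    using assms(4) by (intro fundamental_theorem_of_calculus_interior_strong[OF assms(1,2) _ assms(3)])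
      (simp add: has_real_derivative_iff_has_vector_derivative)
  \<comment> \<open>Nothing is known about \<open>g'\<close> at the end points and on
    \<open>S\<close>. Setting it to 0 there changes it on a negligible set only and makes the
    integrand nonpositive everywhere.\<close>
  then have "((\<lambda>t. if t \<in> {a<..<b} - S then g' t else 0) has_integral (g b - g a)) {a..b}"
    by (rule has_integral_spike[of "S \<union> {a, b}", rotated 2])
      (use assms(1) in \<open>auto intro: negligible_finite\<close>)
  from has_integral_le[OF this has_integral_0] have "g b - g a \<le> 0"
    using assms(5) by simp
  then show ?thesis by simp
qed

text \<open>A positive definite matrix has trivial kernel, hence is invertible. For the gain
  \<open>L\<close> this says \<open>P ** L = Y\<close>, which links the observer to the matrix
  inequality.\<close>

lemma pd_matrix_inv_mult:
  assumes "pd P"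
  shows "P ** (matrix_inv P ** Y) = Y"
proof -
  have "invertible P"
    unfolding invertible_left_inverse matrix_left_invertible_ker
    using assms by (metis inner_zero_right less_irrefl pd_def)
  then have "P ** matrix_inv P = mat 1"
    unfolding invertible_def matrix_inv_def by (rule someI_ex[THEN conjunct1])
  then show ?thesis by (simp add: matrix_mul_assoc)
qed

section \<open>Quadratic forms and the dissipation inequality\<close>

lemma inner_symmetric_matrix: "transpose P = P \<Longrightarrow> a \<bullet> (P *v b) = b \<bullet> (P *v a)" for P :: "real^'l^'l"
  by (metis dot_lmul_matrix inner_commute transpose_matrix_vector)

lemma inner_transpose_matrix: "a \<bullet> (transpose M *v b) = b \<bullet> (M *v a)" for M :: "real^'l^'k"
  by (metis dot_lmul_matrix inner_commute transpose_matrix_vector)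

lemma inner_block_mult:
  fixes M11 :: "real^'a^'a" and M12 :: "real^'b^'a" and M21 :: "real^'a^'b" and M22 :: "real^'b^'b"
  defines "v \<equiv> \<lambda>a b. (\<chi> i. case i of Inl j \<Rightarrow> a $ j | Inr j \<Rightarrow> b $ j) :: real^('a + 'b)"
  shows "v a b \<bullet> (block M11 M12 M21 M22 *v v a b) =
    a \<bullet> (M11 *v a) + a \<bullet> (M12 *v b) + b \<bullet> (M21 *v a) + b \<bullet> (M22 *v b)"
proof -
  have "(block M11 M12 M21 M22 *v v a b) $ Inl i = (M11 *v a) $ i + (M12 *v b) $ i"
    "(block M11 M12 M21 M22 *v v a b) $ Inr j = (M21 *v a) $ j + (M22 *v b) $ j" for i j
    by (simp_all add: block_def vblock_def hblock_def v_def matrix_vector_mult_def sum_UNIV_Plus)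
  then show ?thesis
    by (simp add: inner_vec_def sum_UNIV_Plus distrib_left sum.distrib, simp add: v_def)
qed

text \<open>Evaluate the quadratic form of the matrix inequality at the vector stacked from
  \<open>e\<close> and \<open>d\<close>. Transposed blocks contribute equally, which yields the
  factor 2, and the block \<open>- mat 1\<close> yields the square of the norm of
  \<open>d\<close>.\<close>

lemma lmi_dissipation:
  fixes P Ab :: "real^'l^'l" and Y :: "real^'p^'l" and Cb :: "real^'l^'p" and Bb :: "real^'q^'l"
  assumes P: "pd P"
    and lmi: "block (P ** Ab + transpose Ab ** P - Y ** Cb - transpose Cb ** transpose Y + (2 * \<delta>) *\<^sub>R P)
                     (P ** Bb) (transpose Bb ** P) (- mat 1) \<preceq> 0"
  shows "2 * (e \<bullet> (P *v ((Ab - (matrix_inv P ** Y) ** Cb) *v e + Bb *v d))) \<le>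
    - 2 * \<delta> * (e \<bullet> (P *v e)) + (norm d)\<^sup>2"
proof -
  let ?v = "(\<chi> i. case i of Inl j \<Rightarrow> e $ j | Inr j \<Rightarrow> d $ j) :: real^('l + 'q)"
  let ?B = "block (P ** Ab + transpose Ab ** P - Y ** Cb - transpose Cb ** transpose Y + (2 * \<delta>) *\<^sub>R P)
                     (P ** Bb) (transpose Bb ** P) (- mat 1)"
  have sym: "transpose P = P" using P by (simp add: pd_def)
  have "0 \<le> ?v \<bullet> ((0 - ?B) *v ?v)"
    using lmi unfolding loewner_le_def psd_def by blast
  then have "?v \<bullet> (?B *v ?v) \<le> 0"
    by (simp add: minus_matrix_vector_mult)
  moreover have "e \<bullet> ((transpose Ab ** P) *v e) = e \<bullet> ((P ** Ab) *v e)"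
    unfolding matrix_vector_mul_assoc[symmetric] inner_transpose_matrix
    by (subst inner_commute) (rule inner_symmetric_matrix[OF sym])
  moreover have "e \<bullet> ((transpose Cb ** transpose Y) *v e) = e \<bullet> ((Y ** Cb) *v e)"
    unfolding matrix_transpose_mul[symmetric] by (rule inner_transpose_matrix)
  moreover have "d \<bullet> ((transpose Bb ** P) *v e) = e \<bullet> ((P ** Bb) *v d)"
    unfolding matrix_vector_mul_assoc[symmetric] inner_transpose_matrix
    by (subst inner_commute) (rule inner_symmetric_matrix[OF sym])
  moreover have "P *v ((Ab - (matrix_inv P ** Y) ** Cb) *v e + Bb *v d) =
      (P ** Ab) *v e - (Y ** Cb) *v e + (P ** Bb) *v d"
    by (simp add: matrix_vector_right_distrib matrix_vector_mult_diff_rdistrib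
        matrix_vector_mult_diff_distrib matrix_vector_mul_assoc matrix_mul_assoc
        pd_matrix_inv_mult[OF P, unfolded matrix_mul_assoc])
  ultimately show ?thesis
    unfolding inner_block_mult
    by (simp add: matrix_vector_mult_add_rdistrib matrix_vector_mult_diff_rdistrib
        inner_add_right inner_diff_right minus_matrix_vector_mult power2_norm_eq_inner
        flip: scaleR_matrix_vector_assoc)
qed

text \<open>A Gronwall argument with integrating factor \<open>exp (2 * \<delta> * s)\<close>, valid
  across the finitely many jump instants.\<close>

lemma lyapunov_bound:
  fixes e d :: "real \<Rightarrow> real^'l" and P :: "real^'l^'l"
  assumes P: "pd P" and \<delta>: "0 < \<delta>" and t: "t0 \<le> t"
    and J: "finite (J \<inter> {t0..t})" and cont: "continuous_on {t0..t} e"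
    and der: "\<And>s. t0 < s \<Longrightarrow> s < t \<Longrightarrow> s \<notin> J \<Longrightarrow> (e has_vector_derivative d s) (at s)"
    and diss: "\<And>s. 2 * (e s \<bullet> (P *v d s)) \<le> - 2 * \<delta> * (e s \<bullet> (P *v e s)) + \<epsilon>\<^sup>2"
  shows "e t \<bullet> (P *v e t) \<le> exp (- 2 * \<delta> * (t - t0)) * (e t0 \<bullet> (P *v e t0)) + \<epsilon>\<^sup>2 / (2 * \<delta>)"
proof -
  define V where "V s = e s \<bullet> (P *v e s)" for s
  \<comment> \<open>The constant subtracted is the equilibrium of
    \<open>V' = - 2 * \<delta> * V + \<epsilon>\<^sup>2\<close>, so that \<open>g\<close> is
    nonincreasing.\<close>
  define g where "g s = exp (2 * \<delta> * s) * (V s - \<epsilon>\<^sup>2 / (2 * \<delta>))" for s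
  have sym: "transpose P = P" using P by (simp add: pd_def)
  have "g t \<le> g t0"
  proof (rule nonincreasing_off_finite[OF J t])
    show "continuous_on {t0..t} g"
      unfolding g_def V_def
      by (intro continuous_intros cont bounded_linear.continuous_on[OF matrix_vector_mul_bounded_linear])
    fix s assume s: "s \<in> {t0<..<t} - J \<inter> {t0..t}"
    have "(V has_vector_derivative e s \<bullet> (P *v d s) + d s \<bullet> (P *v e s)) (at s)"
      unfolding V_def
      by (intro bounded_bilinear.has_vector_derivative[OF bounded_bilinear_inner]
          bounded_linear.has_vector_derivative[OF matrix_vector_mul_bounded_linear] der) (use s in auto)
    then have V: "(V has_real_derivative 2 * (e s \<bullet> (P *v d s))) (at s)"
      by (simp add: has_real_derivative_iff_has_vector_derivative inner_symmetric_matrix[OF sym, of "d s"])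
    show "(g has_real_derivative
        exp (2 * \<delta> * s) * (2 * (e s \<bullet> (P *v d s)) + 2 * \<delta> * V s - \<epsilon>\<^sup>2)) (at s)"
      unfolding g_def
      by (rule derivative_eq_intros V refl)+ (use \<delta> in \<open>simp add: field_simps\<close>)
    show "exp (2 * \<delta> * s) * (2 * (e s \<bullet> (P *v d s)) + 2 * \<delta> * V s - \<epsilon>\<^sup>2) \<le> 0"
      using diss[of s] by (intro mult_nonneg_nonpos) (auto simp: V_def)
  qed
  then have "exp (- (2 * \<delta> * t)) * g t \<le> exp (- (2 * \<delta> * t)) * g t0"
    by (rule mult_left_mono) simp
  then have "V t - \<epsilon>\<^sup>2 / (2 * \<delta>) \<le> exp (- 2 * \<delta> * (t - t0)) * (V t0 - \<epsilon>\<^sup>2 / (2 * \<delta>))"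
    by (simp add: g_def algebra_simps flip: exp_add mult.assoc)
  \<comment> \<open>The transient part of the equilibrium term only helps and is dropped from the
    bound.\<close>
  moreover have "0 \<le> exp (- 2 * \<delta> * (t - t0)) * (\<epsilon>\<^sup>2 / (2 * \<delta>))"
    using \<delta> by simp
  ultimately show ?thesis
    by (simp add: V_def algebra_simps)
qed

text \<open>Solving the hypothesis for the norm gives a majorant that converges to the claimed
  bound, because the exponential dies out.\<close>

lemma Limsup_norm_le_of_decay:
  fixes f :: "real \<Rightarrow> 'a::real_normed_vector"
  assumes "0 < \<alpha>" "0 < \<delta>" "0 \<le> \<epsilon>"
    and le: "\<And>t. t0 \<le> t \<Longrightarrow> \<alpha> * (norm (f t))\<^sup>2 \<le> exp (- 2 * \<delta> * (t - t0)) * v + \<epsilon>\<^sup>2 / (2 * \<delta>)"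
  shows "Limsup at_top (\<lambda>t. ereal (norm (f t))) \<le> ereal (\<epsilon> * sqrt (1 / (2 * \<alpha> * \<delta>)))"
proof -
  define b where "b t = sqrt ((exp (- 2 * \<delta> * (t - t0)) * v + \<epsilon>\<^sup>2 / (2 * \<delta>)) / \<alpha>)" for t
  have "norm (f t) \<le> b t" if "t0 \<le> t" for t
    unfolding b_def using le[OF that] assms(1) by (intro real_le_rsqrt) (simp add: field_simps)
  then have "\<forall>\<^sub>F t in at_top. ereal (norm (f t)) \<le> ereal (b t)"
    by (intro eventually_at_top_linorderI[of t0]) simp
  then have "Limsup at_top (\<lambda>t. ereal (norm (f t))) \<le> Limsup at_top (\<lambda>t. ereal (b t))"
    by (rule Limsup_mono)
  moreover have "((\<lambda>t. exp (- 2 * \<delta> * (t - t0))) \<longlongrightarrow> 0) at_top"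
    using assms(2) filterlim_tendsto_add_at_top[OF tendsto_const[of "- t0"] filterlim_ident]
    by (intro filterlim_compose[OF exp_at_bot] filterlim_tendsto_neg_mult_at_bot[OF tendsto_const]) auto
  then have "(b \<longlongrightarrow> sqrt ((0 * v + \<epsilon>\<^sup>2 / (2 * \<delta>)) / \<alpha>)) at_top"
    unfolding b_def by (intro tendsto_intros) (use assms in auto)
  then have "Limsup at_top (\<lambda>t. ereal (b t)) = ereal (sqrt ((0 * v + \<epsilon>\<^sup>2 / (2 * \<delta>)) / \<alpha>))"
    by (intro lim_imp_Limsup) auto
  \<comment> \<open>Here \<epsilon> is nonnegative, so the root of its square is \<epsilon>
    itself.\<close>
  moreover have "sqrt ((0 * v + \<epsilon>\<^sup>2 / (2 * \<delta>)) / \<alpha>) = \<epsilon> * sqrt (1 / (2 * \<alpha> * \<delta>))"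
    using assms by (simp add: real_sqrt_divide real_sqrt_mult)
  ultimately show ?thesis by simp
qed

lemma observer_error_decay:
  fixes A :: "real^'n^'n" and Bu :: "real^'m^'n" and Bw :: "real^'q^'n"
    and Cx :: "real^'n^'p" and Dw :: "real^'q^'p" and w :: "real \<Rightarrow> real^'q"
    and P Ab :: "real^('n + 'k::{finite,linorder} \<times> 'q)^('n + 'k \<times> 'q)"
  assumes Ab: "Ab = A_bar A Bw" and Cb: "Cb = C_bar Cx Dw" and Bb: "Bb = Bw_bar"
    and plant: "solves_off x (\<lambda>t z. A *v z + Bu *v u (t - h) + Bw *v w t)
                   t0 {t. t - h \<in> jumps u (t0 - h)}"
    and measurement: "\<And>t. t0 \<le> t \<Longrightarrow> y t = Cx *v x t + Dw *v w t"
    and disturbance: "times_cont_diff (CARD('k)) w" "\<And>s. norm (nderiv (CARD('k)) w s) \<le> \<epsilon>"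
    and input: "piecewise_constant u (t0 - h)"
    and params: "0 < \<delta>" "pd P"
    and lmi: "block (P ** Ab + transpose Ab ** P - Y ** Cb - transpose Cb ** transpose Y + (2 * \<delta>) *\<^sub>R P)
                     (P ** Bb) (transpose Bb ** P) (- mat 1) \<preceq> 0"
    and L: "L = matrix_inv P ** Y"
    and observer: "solves_off eta_hat
                     (\<lambda>t z. (Ab - L ** Cb) *v z + Bu_bar Bu *v u (t - h) + L *v y t)
                     t0 {t. t - h \<in> jumps u (t0 - h)}"
    and t: "t0 \<le> t"
  defines "e \<equiv> \<lambda>t. eta x w t - eta_hat t"
  shows "e t \<bullet> (P *v e t) \<le> exp (- 2 * \<delta> * (t - t0)) * (e t0 \<bullet> (P *v e t0)) + \<epsilon>\<^sup>2 / (2 * \<delta>)"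
proof (rule lyapunov_bound[OF params(2,1) t])
  let ?d = "\<lambda>s. (Ab - (matrix_inv P ** Y) ** Cb) *v e s + Bb *v nderiv (CARD('k)) w s"
  show "finite ({t. t - h \<in> jumps u (t0 - h)} \<inter> {t0..t})"
    by (rule finite_shifted_jumps[OF input])
  show "continuous_on {t0..t} e"
    unfolding e_def using plant observer unfolding solves_off_def
    by (intro continuous_on_diff continuous_on_eta disturbance(1)) (auto intro: continuous_on_subset)
  show "(e has_vector_derivative ?d s) (at s)"
    if s: "t0 < s" "s < t" "s \<notin> {t. t - h \<in> jumps u (t0 - h)}" for s
  proof -
    have "(eta x w has_vector_derivative
        Ab *v eta x w s + Bu_bar Bu *v u (s - h) + Bb *v nderiv (CARD('k)) w s) (at s)"
      unfolding Ab Bb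
      using solves_off_has_vector_derivative[OF plant s(1,3)]
      by (intro eta_has_vector_derivative disturbance(1)) auto
    \<comment> \<open>The augmented state and its estimate receive the same input, so the input
      terms cancel in the difference.\<close>
    from has_vector_derivative_diff[OF this solves_off_has_vector_derivative[OF observer s(1,3)]]
    have "(e has_vector_derivative Ab *v eta x w s + Bu_bar Bu *v u (s - h) + Bb *v nderiv (CARD('k)) w s -
        ((Ab - L ** Cb) *v eta_hat s + Bu_bar Bu *v u (s - h) + L *v y s)) (at s)"
      unfolding e_def .
    \<comment> \<open>The output injection acts through \<open>Cb\<close> on the true augmented
      state; combined with the observer term it acts on the error alone.\<close>
    moreover have "L *v y s = (L ** Cb) *v eta x w s"
      using s by (simp add: measurement Cb C_bar_mult_eta flip: matrix_vector_mul_assoc)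
    ultimately show ?thesis
      by (simp add: e_def L matrix_vector_mult_diff_rdistrib matrix_vector_mult_diff_distrib algebra_simps)
  qed
  show "2 * (e s \<bullet> (P *v ?d s)) \<le> - 2 * \<delta> * (e s \<bullet> (P *v e s)) + \<epsilon>\<^sup>2" for s
    using lmi_dissipation[OF params(2) lmi, of "e s" "nderiv (CARD('k)) w s"]
      power_mono[OF disturbance(2)[of s] norm_ge_zero, of 2] by linarith
qed

section \<open>Prediction error: decomposition and bounds\<close>

theorem theorem2:
  fixes A :: "real^'n^'n" and Bu :: "real^'m^'n" and Bw :: "real^'q^'n"
    and Cx :: "real^'n^'p" and Dw :: "real^'q^'p"
    and r :: nat and h T \<epsilon> t0 \<alpha> \<delta> :: real
    and x :: "real \<Rightarrow> real^'n" and u :: "real \<Rightarrow> real^'m"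
    and w :: "real \<Rightarrow> real^'q" and y :: "real \<Rightarrow> real^'p"
    and ND MD :: "real^'d^'d"
    and P :: "real^('n + 'k::{finite,linorder} \<times> 'q)^('n + 'k \<times> 'q)"
    and Y L :: "real^'p^('n + 'k \<times> 'q)"
    and Ab :: "real^('n + 'k \<times> 'q)^('n + 'k \<times> 'q)"
    and Cb :: "real^('n + 'k \<times> 'q)^'p"
    and Bb :: "real^'q^('n + 'k \<times> 'q)"
    and K :: "real^('n + 'k \<times> 'q)^'n"
    and eta_hat :: "real \<Rightarrow> real^('n + 'k \<times> 'q)"
  assumes r: "CARD('k) = r + 1"
    and nonneg: "0 \<le> h" "0 \<le> T" "0 \<le> \<epsilon>"
    and Ab: "Ab = A_bar A Bw" and Cb: "Cb = C_bar Cx Dw" and Bb: "Bb = Bw_bar"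
    and K: "K = K_mat A Bw T"
    and plant: "solves_off x (\<lambda>t z. A *v z + Bu *v u (t - h) + Bw *v w t)
                   t0 {t. t - h \<in> jumps u (t0 - h)}"
    and measurement: "\<And>t. t0 \<le> t \<Longrightarrow> y t = Cx *v x t + Dw *v w t"
    and disturbance: "times_cont_diff (r + 1) w" "\<And>s. norm (nderiv (r + 1) w s) \<le> \<epsilon>"
    and input: "piecewise_constant u (t0 - h)"
    and observable: "observable Ab Cb"
    and region: "transpose ND = ND" "bounded (lmi_region ND MD)"
    and params: "0 < \<alpha>" "0 < \<delta>" "pd P"
    and lmi1: "block (P ** Ab + transpose Ab ** P - Y ** Cb - transpose Cb ** transpose Y + (2 * \<delta>) *\<^sub>R P)
                     (P ** Bb) (transpose Bb ** P) (- mat 1) \<preceq> 0"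
    and lmi2: "0 \<preceq> P - \<alpha> *\<^sub>R (transpose K ** K)"
    and lmi3: "kron ND P + kron MD (P ** Ab - Y ** Cb)
                 + kron (transpose MD) (transpose (P ** Ab - Y ** Cb)) \<prec> 0"
    and L: "L = matrix_inv P ** Y"
    and observer: "solves_off eta_hat
                     (\<lambda>t z. (Ab - L ** Cb) *v z + Bu_bar Bu *v u (t - h) + L *v y t)
                     t0 {t. t - h \<in> jumps u (t0 - h)}"
  shows "(\<forall>t\<ge>t0. \<forall>N tk uk x_hat. input_partition u h T t N tk uk \<longrightarrow>
            x_hat = K *v eta_hat t + Gamma_u_times A Bu h T t N tk uk \<longrightarrow>
            x (t + T) - x_hat = O_r A Bw r w T t + O_e A Bw T x w eta_hat t) \<and>
         (\<forall>t\<ge>t0. \<exists>\<mu>.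
            (\<exists>s\<in>{t..t + T}. \<mu> = onorm ((*v) (Gamma_w A r (t + T - s) ** Bw))) \<and>
            (\<forall>s\<in>{t..t + T}. onorm ((*v) (Gamma_w A r (t + T - s) ** Bw)) \<le> \<mu>) \<and>
            norm (O_r A Bw r w T t) \<le> T ^ (r + 2) / fact (r + 2) * \<mu> * \<epsilon> \<and>
            (\<epsilon> = 0 \<longrightarrow> T ^ (r + 2) / fact (r + 2) * \<mu> * \<epsilon> = 0)) \<and>
         Limsup at_top (\<lambda>t. ereal (norm (O_e A Bw T x w eta_hat t))) \<le> ereal (\<epsilon> * sqrt (1 / (2 * \<alpha> * \<delta>))) \<and>
         (\<epsilon> = 0 \<longrightarrow> \<epsilon> * sqrt (1 / (2 * \<alpha> * \<delta>)) = 0)"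
proof (intro conjI allI impI)
  fix t N tk uk x_hat
  assume t: "t0 \<le> t" and part: "input_partition u h T t N tk uk"
    and x_hat: "x_hat = K *v eta_hat t + Gamma_u_times A Bu h T t N tk uk"
  \<comment> \<open>At the start of the horizon the remaining time is \<open>T\<close>, and
    \<open>CARD('k) = r + 1\<close> matches the number of disturbance terms.\<close>
  have "predictor A Bw r x w (t + T) t = K *v eta x w t"
    by (simp add: predictor_def K K_mat_mult_eta r)
  then show "x (t + T) - x_hat = O_r A Bw r w T t + O_e A Bw T x w eta_hat t"
    using predictor_increment[OF plant disturbance(1) input t part]
    by (simp add: x_hat O_e_def K matrix_vector_mult_diff_distrib algebra_simps)
next
  fix t
  obtain s where s: "s \<in> {t..t + T}" and max: "\<forall>s'\<in>{t..t + T}.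
      onorm ((*v) (Gamma_w A r (t + T - s') ** Bw)) \<le> onorm ((*v) (Gamma_w A r (t + T - s) ** Bw))"
    using max_onorm_Gamma_w[OF nonneg(2)] by blast
  have "norm (O_r A Bw r w T t) \<le>
      T ^ (r + 2) / fact (r + 2) * onorm ((*v) (Gamma_w A r (t + T - s) ** Bw)) * \<epsilon>"
    using max by (intro norm_O_r_le nonneg(2) disturbance) blast
  with s max show "\<exists>\<mu>.
      (\<exists>s\<in>{t..t + T}. \<mu> = onorm ((*v) (Gamma_w A r (t + T - s) ** Bw))) \<and>
      (\<forall>s\<in>{t..t + T}. onorm ((*v) (Gamma_w A r (t + T - s) ** Bw)) \<le> \<mu>) \<and>
      norm (O_r A Bw r w T t) \<le> T ^ (r + 2) / fact (r + 2) * \<mu> * \<epsilon> \<and>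
      (\<epsilon> = 0 \<longrightarrow> T ^ (r + 2) / fact (r + 2) * \<mu> * \<epsilon> = 0)"
    by (intro exI[of _ "onorm ((*v) (Gamma_w A r (t + T - s) ** Bw))"]) auto
next
  define e where "e t = eta x w t - eta_hat t" for t
  show "Limsup at_top (\<lambda>t. ereal (norm (O_e A Bw T x w eta_hat t))) \<le> ereal (\<epsilon> * sqrt (1 / (2 * \<alpha> * \<delta>)))"
  proof (rule Limsup_norm_le_of_decay[OF params(1,2) nonneg(3)])
    fix t assume t: "t0 \<le> t"
    have w: "times_cont_diff (CARD('k)) w" "\<And>s. norm (nderiv (CARD('k)) w s) \<le> \<epsilon>"
      using disturbance r by simp_all
    \<comment> \<open>The second matrix inequality, evaluated at the observer error, compares the
      output of \<open>K\<close> with the Lyapunov function.\<close>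
    have "0 \<le> e t \<bullet> ((P - \<alpha> *\<^sub>R (transpose K ** K) - 0) *v e t)"
      using lmi2 unfolding loewner_le_def psd_def by blast
    moreover have "e t \<bullet> ((transpose K ** K) *v e t) = (norm (K *v e t))\<^sup>2"
      unfolding matrix_vector_mul_assoc[symmetric] inner_transpose_matrix power2_norm_eq_inner ..
    ultimately have "\<alpha> * (norm (K *v e t))\<^sup>2 \<le> e t \<bullet> (P *v e t)"
      by (simp add: matrix_vector_mult_diff_rdistrib inner_diff_right flip: scaleR_matrix_vector_assoc)
    also have "\<dots> \<le> exp (- 2 * \<delta> * (t - t0)) * (e t0 \<bullet> (P *v e t0)) + \<epsilon>\<^sup>2 / (2 * \<delta>)"
      unfolding e_def
      by (rule observer_error_decay[OF Ab Cb Bb plant measurement w input params(2,3) lmi1 L observer t])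
    finally show "\<alpha> * (norm (O_e A Bw T x w eta_hat t))\<^sup>2 \<le>
        exp (- 2 * \<delta> * (t - t0)) * (e t0 \<bullet> (P *v e t0)) + \<epsilon>\<^sup>2 / (2 * \<delta>)"
      by (simp add: O_e_def K e_def)
  qed
qed simp

end
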